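(* Let $S\in\mathbb{S}^d_m$, $Y\in\mathcal{L}_2(\mathbb{R}^d)$, $\nu:=\mathrm{Law}(Y)$. Let $G\in\mathcal{M}(S)$ be an optimal set for the dual problem and assume $\nu(\Sigma(P_G))=0$, i.e. $P_G(Y)$ is a.s. single-valued. Then $X:=P_G(Y)\mathbf{1}_{\{Y\notin\Sigma(P_G)\}}$ is the unique optimal map and $\mathrm{Law}(X,Y)$ is the unique optimal plan.
   Context: $\mathbb{S}^d_m$: symmetric invertible $d\times d$ real matrices with exactly $m$ positive eigenvalues; $S(x,y):=\langle x,Sy\rangle$. $G\subset\mathbb{R}^d$ is $S$-monotone if $S(x-y,x-y)\ge0$ for $x,y\in G$; maximal if not a strict subset of another $S$-monotone set; $\mathcal{M}(S)$ is the family of maximal $S$-monotone sets. $\psi_G(y):=\sup_{x\in G}(S(x,y)-\frac12S(x,x))$, $P_G(y):=\operatorname{argmax}_{x\in G}(S(x,y)-\frac12S(x,x))$ (its unique element is meant where it is a singleton). $\Sigma(P_G):=\{y:P_G(y)\ne\emptyset\text{ and is not a single point}\}$. $\mathcal{X}(Y):=\{X\in\mathcal{L}_2(\mathbb{R}^d):X\ Y\text{-measurable},\ \mathbb{E}[Y|X]=X\}$; an optimal map maximizes $\frac12\mathbb{E}[S(X,Y)]$ over $\mathcal{X}(Y)$. $\Gamma(\nu)$: Borel probability measures on $\mathbb{R}^d\times\mathbb{R}^d$ (coordinates $(x,y)$) with finite second moments, second marginal $\nu$, and conditional expectation of $y$ given $x$ equal to $x$; an optimal plan maximizes $\frac12\int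 S(x,y)d\gamma$ over $\Gamma(\nu)$. An optimal set of the dual problem minimizes $\int\psi_H\,d\nu$ over $H\in\mathcal{M}(S)$. Relations between random variables hold a.s. *)

theory Defs
  imports "HOL-Probability.Probability" "HOL-Probability.Conditional_Expectation"
begin

text \<open>S^d_m: symmetric invertible d x d real matrices with exactly m positive eigenvalues
  (counted with multiplicity, via an orthonormal eigenbasis).\<close>
definition Sdm :: "nat \<Rightarrow> (real^'n^'n) set" where
  "Sdm m = {S. transpose S = S \<and> invertible S \<and>
     (\<exists>(v :: 'n \<Rightarrow> real^'n) (lam :: 'n \<Rightarrow> real).
        (\<forall>i j. v i \<bullet> v j = (if i = j then 1 else 0)) \<and>
        (\<forall>i. S *v v i = lam i *\<^sub>R v i) \<and>
        card {i. lam i > 0} = m)}"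

definition Sform :: "real^'n^'n \<Rightarrow> real^'n \<Rightarrow> real^'n \<Rightarrow> real" where
  "Sform S x y = x \<bullet> (S *v y)"

definition S_monotone :: "real^'n^'n \<Rightarrow> (real^'n) set \<Rightarrow> bool" where
  "S_monotone S G \<longleftrightarrow> (\<forall>x\<in>G. \<forall>y\<in>G. Sform S (x - y) (x - y) \<ge> 0)"

definition maximal_S_monotone :: "real^'n^'n \<Rightarrow> (real^'n) set \<Rightarrow> bool" where
  "maximal_S_monotone S G \<longleftrightarrow>
     S_monotone S G \<and> (\<forall>H. S_monotone S H \<and> G \<subseteq> H \<longrightarrow> H = G)"

definition MS :: "real^'n^'n \<Rightarrow> (real^'n) set set" where
  "MS S = {G. maximal_S_monotone S G}"

definition psi :: "real^'n^'n \<Rightarrow> (real^'n) set \<Rightarrow> real^'n \<Rightarrow> ereal" where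
  "psi S G y = (SUP x\<in>G. ereal (Sform S x y - Sform S x x / 2))"

definition PG :: "real^'n^'n \<Rightarrow> (real^'n) set \<Rightarrow> real^'n \<Rightarrow> (real^'n) set" where
  "PG S G y = {x\<in>G. \<forall>x'\<in>G. Sform S x' y - Sform S x' x' / 2 \<le> Sform S x y - Sform S x x / 2}"

definition Sigma_PG :: "real^'n^'n \<Rightarrow> (real^'n) set \<Rightarrow> (real^'n) set" where
  "Sigma_PG S G = {y. PG S G y \<noteq> {} \<and> \<not> (\<exists>x. PG S G y = {x})}"

definition L2 :: "'w measure \<Rightarrow> ('w \<Rightarrow> real^'n) \<Rightarrow> bool" where
  "L2 M X \<longleftrightarrow> X \<in> borel_measurable M \<and> integrable M (\<lambda>\<omega>. (norm (X \<omega>))\<^sup>2)"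

definition Xset :: "'w measure \<Rightarrow> ('w \<Rightarrow> real^'n) \<Rightarrow> ('w \<Rightarrow> real^'n) set" where
  "Xset M Y = {X. L2 M X \<and> X \<in> measurable (vimage_algebra (space M) Y borel) borel \<and>
     (\<forall>i. AE \<omega> in M. real_cond_exp M (vimage_algebra (space M) X borel) (\<lambda>\<omega>. Y \<omega> $ i) \<omega> = X \<omega> $ i)}"

definition optimal_map :: "real^'n^'n \<Rightarrow> 'w measure \<Rightarrow> ('w \<Rightarrow> real^'n) \<Rightarrow> ('w \<Rightarrow> real^'n) \<Rightarrow> bool" where
  "optimal_map S M Y X \<longleftrightarrow> X \<in> Xset M Y \<and>
     (\<forall>X'\<in>Xset M Y. (\<integral>\<omega>. Sform S (X' \<omega>) (Y \<omega>) \<partial>M) / 2 \<le> (\<integral>\<omega>. Sform S (X \<omega>) (Y \<omega>) \<partial>M) / 2)"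

definition Gamma :: "(real^'n) measure \<Rightarrow> ((real^'n) \<times> (real^'n)) measure set" where
  "Gamma nu = {\<gamma>. sets \<gamma> = sets borel \<and> prob_space \<gamma> \<and>
     integrable \<gamma> (\<lambda>p. (norm p)\<^sup>2) \<and> distr \<gamma> borel snd = nu \<and>
     (\<forall>i. AE p in \<gamma>. real_cond_exp \<gamma> (vimage_algebra (space \<gamma>) fst borel) (\<lambda>p. snd p $ i) p = fst p $ i)}"

definition optimal_plan :: "real^'n^'n \<Rightarrow> (real^'n) measure \<Rightarrow> ((real^'n) \<times> (real^'n)) measure \<Rightarrow> bool" where
  "optimal_plan S nu \<gamma> \<longleftrightarrow> \<gamma> \<in> Gamma nu \<and>
     (\<forall>\<gamma>'\<in>Gamma nu. (\<integral>p. Sform S (fst p) (snd p) \<partial>\<gamma>') / 2 \<le> (\<integral>p. Sform S (fst p) (snd p) \<partial>\<gamma>) / 2)"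

text \<open>Extended-real integral of psi_H (positive part minus negative part).\<close>
definition dual_obj :: "real^'n^'n \<Rightarrow> (real^'n) measure \<Rightarrow> (real^'n) set \<Rightarrow> ereal" where
  "dual_obj S nu H = enn2ereal (\<integral>\<^sup>+ y. e2ennreal (psi S H y) \<partial>nu)
                     - enn2ereal (\<integral>\<^sup>+ y. e2ennreal (- psi S H y) \<partial>nu)"

definition optimal_dual_set :: "real^'n^'n \<Rightarrow> (real^'n) measure \<Rightarrow> (real^'n) set \<Rightarrow> bool" where
  "optimal_dual_set S nu G \<longleftrightarrow> G \<in> MS S \<and> (\<forall>H\<in>MS S. dual_obj S nu G \<le> dual_obj S nu H)"

end

theory Submission
  imports Defs
begin

text \<open>
  Write \<open>c(y) = S(y,y)/2\<close> and let \<open>P\<close> be the spectral projection onto the positive space of \<open>S\<close>.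
  Every convex majorant of \<open>c\<close> dominates \<open>\<psi>\<^sub>H\<close> for some maximal \<open>H\<close>, and \<open>P\<close> maps every maximal set \<open>G\<close>
  bijectively onto the positive space, with Lipschitz inverse. Hence, by Brouwer's theorem, moving the
  points of \<open>G\<close> along any bounded continuous field \<open>\<phi>\<close> yields a set \<open>G\<^sub>t\<close> whose \<open>\<psi>\<close> still majorises \<open>c\<close>,
  so optimality of \<open>G\<close> gives \<open>\<integral>\<psi>\<^bsub>G\<^esub> d\<nu> \<le> \<integral>\<psi>\<^bsub>G_t\<^esub> d\<nu>\<close>. Differentiating at \<open>t = 0\<close>
  (envelope theorem and Fatou's lemma) shows that \<open>P\<^sub>G(Y)\<close> is nonempty and \<open>E[S(\<phi>(X), Y - X)] = 0\<close>, which is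
  the martingale property of \<open>X\<close>. Optimality and uniqueness come from weak duality: for a martingale
  pair \<open>(U, V)\<close>, bound \<open>\<psi>\<^sub>G(V)\<close> below by the tangent at the point \<open>z\<close> of \<open>G\<close> with \<open>P z = P U\<close>; equality forces
  \<open>U \<in> P\<^sub>G(V)\<close>.
\<close>

section \<open>The spectral splitting\<close>

text \<open>The obstacle is that a moved copy of \<open>G\<close> is in general not S-monotone,
  hence not a competitor in the dual problem. What survives the motion is that every
  \<open>y\<close> still has a tangent of height at least \<open>c(y)\<close>, and this is exactly
  what the domination theorem converts into a maximal competitor with a pointwise smaller or equal
  \<psi>. Two unknowns shape the test fields: \<open>PG S G y\<close> may be empty, and its points
  have no known moments. Therefore \<phi> has compact support, and a velocity \<open>e\<close> times
  \<open>P x\<close> is added. The latter confines the relevant points of \<open>G\<close> to a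
  bounded set at fixed \<open>y\<close>, at a price of at most a multiple of \<open>e |y|^2\<close>,
  which disappears as \<open>e\<close> tends to 0. Square integrability of the projection is then
  itself a consequence of stationarity. Weak duality is formulated for a martingale pair on any
  probability space. The coordinates of a plan form such a pair, so one equality case yields
  uniqueness of both the map and the plan.\<close>

lemma bounded_bilinear_Sform: "bounded_bilinear (Sform S)"
  unfolding Sform_def
  using bounded_bilinear.comp[OF bounded_bilinear_inner bounded_linear_ident matrix_vector_mul_bounded_linear[of S]]
  by simp

global_interpretation Sform: bounded_bilinear "Sform S" for S
  by (rule bounded_bilinear_Sform)

text \<open>The affine function of \<open>y\<close> that touches \<open>c\<close> to first order at
  \<open>x\<close>; \<psi> is the supremum of these functions over the set.\<close>

definition tangent :: "real^'n^'n \<Rightarrow> real^'n \<Rightarrow> real^'n \<Rightarrow> real" where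
  "tangent S x y = Sform S x y - Sform S x x / 2"

text \<open>By completing the square this says that at every \<open>y\<close> some tangent based in
  \<open>A\<close> reaches at least \<open>c(y)\<close>, so that \<psi> of \<open>A\<close>
  majorises \<open>c\<close>.\<close>

definition covers :: "real^'n^'n \<Rightarrow> (real^'n) set \<Rightarrow> bool" where
  "covers S A \<longleftrightarrow> (\<forall>y. \<exists>x\<in>A. Sform S (y - x) (y - x) \<le> 0)"

text \<open>All that is kept of the spectrum: an S-orthogonal projection with uniform definiteness
  of \<open>S\<close> on its range and on its kernel, and invertibility in the form that every
  linear functional is represented by \<open>S\<close>.\<close>

locale sign_split =
  fixes S :: "real^'n^'n" and P :: "real^'n \<Rightarrow> real^'n" and \<kappa> :: real
  assumes Sform_sym: "Sform S x y = Sform S y x"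
    and linear_P: "linear P"
    and P_idem: "P (P x) = P x"
    and P_orth: "Sform S (P x) (y - P y) = 0"
    and \<kappa>_pos: "\<kappa> > 0"
    and P_pos: "\<kappa> * (norm (P x))\<^sup>2 \<le> Sform S (P x) (P x)"
    and P_neg: "Sform S (x - P x) (x - P x) \<le> - \<kappa> * (norm (x - P x))\<^sup>2"
    and nondeg: "\<exists>z. \<forall>y. Sform S z y = n \<bullet> y"

lemma Sdm_sign_split:
  assumes "S \<in> Sdm m"
  shows "\<exists>P \<kappa>. sign_split S P \<kappa>"
proof -
  obtain v :: "'a \<Rightarrow> real^'a" and lam where
    sym: "transpose S = S" and inv: "invertible S"
    and on: "\<And>i j. v i \<bullet> v j = (if i = j then 1 else 0)"
    and ev: "\<And>i. S *v v i = lam i *\<^sub>R v i"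
    using assms unfolding Sdm_def by blast
  have S_sym: "Sform S x y = Sform S y x" for x y
    unfolding Sform_def using dot_lmul_matrix[of x S y] transpose_matrix_vector[of S x]
    by (simp add: sym inner_commute)
  have v_inj: "inj v"
    using on by (metis inj_def zero_neq_one)
  have span_v: "span (range v) = UNIV"
  proof -
    have ind: "independent (range v)"
    proof (rule pairwise_orthogonal_independent)
      show "pairwise orthogonal (range v)" using on by (auto simp: pairwise_def orthogonal_def)
      show "0 \<notin> range v" using on by (metis imageE inner_zero_left zero_neq_one)
    qed
    have "card (range v) = CARD('a)" using v_inj by (simp add: card_image)
    then have "dim (range v) = dim (UNIV :: (real^'a) set)"
      using ind by (simp add: dim_eq_card_independent)
    then show ?thesis by (metis dim_eq_full dim_UNIV)
  qed
  have expand: "x = (\<Sum>i\<in>UNIV. (x \<bullet> v i) *\<^sub>R v i)" for x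
  proof -
    let ?d = "x - (\<Sum>i\<in>UNIV. (x \<bullet> v i) *\<^sub>R v i)"
    have "?d \<bullet> v j = 0" for j
      by (simp add: inner_diff_left inner_sum_left on if_distrib[of "\<lambda>z. _ * z"] cong: if_cong)
    then have "orthogonal ?d w" if "w \<in> span (range v)" for w
      using that by (intro orthogonal_to_span[OF that]) (auto simp: orthogonal_def)
    then have "orthogonal ?d ?d" using span_v by blast
    then show ?thesis by (simp add: orthogonal_self)
  qed
  have lam0: "lam i \<noteq> 0" for i
  proof
    assume "lam i = 0"
    then have "S *v v i = 0" using ev by simp
    then have "v i = 0" using inv by (metis invertible_def matrix_vector_mul_assoc matrix_vector_mul_lid matrix_vector_mult_0_right)
    then show False using on[of i i] by simp
  qed
  have S_diag: "Sform S x y = (\<Sum>i\<in>UNIV. lam i * (x \<bullet> v i) * (y \<bullet> v i))" for x y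
  proof -
    have "S *v y = (\<Sum>i\<in>UNIV. (y \<bullet> v i) *\<^sub>R (lam i *\<^sub>R v i))"
      using arg_cong[OF expand[of y], of "(*v) S"]
      by (simp add: linear_sum[OF matrix_vector_mul_linear] matrix_vector_mult_scaleR ev)
    then show ?thesis by (simp add: Sform_def inner_sum_right ac_simps)
  qed
  have norm_diag: "(norm x)\<^sup>2 = (\<Sum>i\<in>UNIV. (x \<bullet> v i)\<^sup>2)" for x
  proof -
    have "x \<bullet> x = x \<bullet> (\<Sum>i\<in>UNIV. (x \<bullet> v i) *\<^sub>R v i)" by (rule arg_cong[OF expand])
    then show ?thesis by (simp only: power2_norm_eq_inner) (simp add: inner_sum_right power2_eq_square)
  qed
  define I where "I = {i. lam i > 0}"
  define P where "P x = (\<Sum>i\<in>I. (x \<bullet> v i) *\<^sub>R v i)" for x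
  have Pv: "P x \<bullet> v j = (if j \<in> I then x \<bullet> v j else 0)" for x j
    by (simp add: P_def inner_sum_left on if_distrib[of "\<lambda>z. _ * z"] cong: if_cong)
  \<comment> \<open>The smallest absolute eigenvalue serves both signs; it is positive because
    invertibility excludes the eigenvalue 0.\<close>
  define \<kappa> where "\<kappa> = Min (range (\<lambda>i. \<bar>lam i\<bar>))"
  have \<kappa>: "\<kappa> > 0" unfolding \<kappa>_def using lam0 by (subst Min_gr_iff) auto
  have \<kappa>le: "\<kappa> \<le> \<bar>lam i\<bar>" for i unfolding \<kappa>_def by (rule Min_le) auto
  have "sign_split S P \<kappa>"
  proof (rule sign_split.intro)
    show "Sform S x y = Sform S y x" for x y by (rule S_sym)
    show "linear P" unfolding P_def
      by (rule linearI) (simp_all add: inner_add_left scaleR_add_left sum.distrib scaleR_right.sum)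
    show "P (P x) = P x" for x
      unfolding P_def[of "P x"] Pv by (simp add: P_def)
    show "Sform S (P x) (y - P y) = 0" for x y
      unfolding S_diag by (rule sum.neutral) (auto simp: Pv inner_diff_left)
    show "\<kappa> > 0" by (rule \<kappa>)
    show "\<kappa> * (norm (P x))\<^sup>2 \<le> Sform S (P x) (P x)" for x
      unfolding S_diag norm_diag sum_distrib_left
    proof (rule sum_mono)
      fix i
      show "\<kappa> * (P x \<bullet> v i)\<^sup>2 \<le> lam i * (P x \<bullet> v i) * (P x \<bullet> v i)"
        using \<kappa>le[of i] by (auto simp: Pv I_def power2_eq_square mult.assoc intro!: mult_right_mono)
    qed
    show "Sform S (x - P x) (x - P x) \<le> - \<kappa> * (norm (x - P x))\<^sup>2" for x
      unfolding S_diag norm_diag sum_distrib_left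
    proof (rule sum_mono)
      fix i
      show "lam i * ((x - P x) \<bullet> v i) * ((x - P x) \<bullet> v i) \<le> - \<kappa> * ((x - P x) \<bullet> v i)\<^sup>2"
      proof (cases "i \<in> I")
        case False
        then have "lam i \<le> - \<kappa>" using \<kappa>le[of i] by (auto simp: I_def)
        then show ?thesis
          using mult_right_mono[of "lam i" "-\<kappa>" "((x - P x) \<bullet> v i)\<^sup>2"] by (simp add: power2_eq_square mult.assoc)
      qed (simp add: Pv inner_diff_left)
    qed
    show "\<exists>z. \<forall>y. Sform S z y = n \<bullet> y" for n
    proof -
      obtain T where "S ** T = mat 1" using inv by (auto simp: invertible_def)
      then have "S *v (T *v n) = n" by (simp add: matrix_vector_mul_assoc)
      then show ?thesis using S_sym unfolding Sform_def by (metis inner_commute)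
    qed
  qed
  then show ?thesis by blast
qed

context sign_split
begin

text \<open>Completing the square. It translates signs of \<open>S\<close> on differences into the
  position of tangents relative to \<open>c\<close>: monotone sets have tangents below
  \<open>c\<close> at their own points, covering sets have tangents above \<open>c\<close> somewhere
  over each point.\<close>

lemma tangent_eq: "tangent S x y = Sform S y y / 2 - Sform S (y - x) (y - x) / 2"
  by (simp add: tangent_def Sform.diff_left Sform.diff_right Sform_sym[of y x] field_simps)

lemma Sform_split: "Sform S x y = Sform S (P x) (P y) + Sform S (x - P x) (y - P y)"
proof -
  have "Sform S x y = Sform S (P x + (x - P x)) (P y + (y - P y))" by simp
  also have "\<dots> = Sform S (P x) (P y) + Sform S (x - P x) (y - P y)"
    unfolding Sform.add_left Sform.add_right P_orth Sform_sym[of "x - P x" "P y"] by simp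
  finally show ?thesis .
qed

lemma Sform_P_left: "Sform S (P x) y = Sform S (P x) (P y)"
  by (subst Sform_split) (simp add: P_idem Sform.zero_left)

lemma P_diff: "P (x - y) = P x - P y" and P_add: "P (x + y) = P x + P y"
  and P_scale: "P (r *\<^sub>R x) = r *\<^sub>R P x"
  using linear_P by (auto simp: linear_diff linear_add linear_scale)

lemma Sform_P_nonneg: "0 \<le> Sform S (P x) (P x)"
  using \<kappa>_pos by (intro order_trans[OF _ P_pos]) simp

lemma Sform_ker_P_le:
  assumes "P x = 0" shows "Sform S x x \<le> - \<kappa> * (norm x)\<^sup>2"
  using P_neg[of x] assms by simp

lemma Sform_ker_P_nonpos:
  assumes "P x = 0" shows "Sform S x x \<le> 0"
  using \<kappa>_pos by (intro order_trans[OF Sform_ker_P_le[OF assms]]) simp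

lemma Sform_ker_P_eq_0:
  assumes "P x = 0" "Sform S x x \<ge> 0" shows "x = 0"
proof -
  have "\<kappa> * (norm x)\<^sup>2 \<le> 0" using Sform_ker_P_le[OF assms(1)] assms(2) by simp
  then show ?thesis using \<kappa>_pos by (simp add: mult_le_0_iff)
qed

text \<open>A point added to \<open>H\<close> shares its projection with some point of
  \<open>H\<close>. Their difference lies in the kernel of \<open>P\<close>, where \<open>S\<close>
  is negative definite, while monotonicity makes \<open>S\<close> nonnegative on it, so it
  vanishes.\<close>

lemma monotone_full_maximal:
  assumes "S_monotone S H" and "\<And>a. \<exists>x\<in>H. P x = P a"
  shows "H \<in> MS S"
  unfolding MS_def maximal_S_monotone_def mem_Collect_eq
proof (intro conjI allI impI)
  fix H' assume H': "S_monotone S H' \<and> H \<subseteq> H'"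
  have "z \<in> H" if "z \<in> H'" for z
  proof -
    obtain x where x: "x \<in> H" "P x = P z" using assms(2) by blast
    have "z - x = 0"
    proof (rule Sform_ker_P_eq_0)
      show "P (z - x) = 0" using x by (simp add: P_diff)
      show "0 \<le> Sform S (z - x) (z - x)" using H' that x(1) unfolding S_monotone_def by blast
    qed
    then show ?thesis using x by simp
  qed
  then show "H' = H" using H' by blast
qed (rule assms)

text \<open>A point \<open>y\<close> with \<open>S\<close> strictly positive on all differences to
  \<open>G\<close> could be added to \<open>G\<close>; but then \<open>y\<close> belongs to
  \<open>G\<close> and is its own witness.\<close>

lemma maximal_covers:
  assumes "G \<in> MS S" shows "covers S G"
  unfolding covers_def
proof (rule allI, rule ccontr)
  fix y assume *: "\<not> (\<exists>x\<in>G. Sform S (y - x) (y - x) \<le> 0)"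
  have G: "S_monotone S G" "\<And>H. S_monotone S H \<Longrightarrow> G \<subseteq> H \<Longrightarrow> H = G"
    using assms by (auto simp: MS_def maximal_S_monotone_def)
  have swap: "Sform S (x - y) (x - y) = Sform S (y - x) (y - x)" for x
    using Sform.minus_left[of S "y - x" "x - y"] Sform.minus_right[of S "y - x" "y - x"] by simp
  have "S_monotone S (insert y G)"
    using G(1) * by (auto simp: S_monotone_def swap Sform.zero_left not_le less_imp_le)
  then have "y \<in> G" using G(2)[of "insert y G"] by blast
  then show False using * by (auto simp: Sform.zero_left)
qed

end

section \<open>Maximal monotone sets below a convex majorant\<close>

context sign_split
begin

lemma Sform_convex_combination:
  assumes "u + v = 1"
  shows "Sform S (u *\<^sub>R x + v *\<^sub>R y) (u *\<^sub>R x + v *\<^sub>R y)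
    = u * Sform S x x + v * Sform S y y - u * v * Sform S (y - x) (y - x)"
proof -
  have u: "u = 1 - v" using assms by simp
  show ?thesis unfolding u
    by (simp add: Sform.add_left Sform.add_right Sform.diff_left Sform.diff_right Sform.scaleR_left
        Sform.scaleR_right Sform_sym[of y x] algebra_simps)
qed

text \<open>A hyperplane separates \<open>E\<close> from the hypograph of a concave minorant
  \<open>k\<close> of \<open>c\<close>. Since \<open>k\<close> is affine along the positive space
  with slope given by \<open>P a\<close>, every affine majorant of \<open>k\<close> has that slope
  there, which prescribes the projection of the base point \<open>z\<close>.\<close>

lemma exists_tangent_below:
  fixes E :: "((real^'n) \<times> real) set"
  assumes E: "convex E" "E \<noteq> {}" and above: "\<And>y r. (y, r) \<in> E \<Longrightarrow> Sform S y y / 2 \<le> r"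
  shows "\<exists>z. P z = P a \<and> (\<forall>(y, r)\<in>E. tangent S z y \<le> r)"
proof -
  \<comment> \<open>The concave minorant of \<open>y \<mapsto> S(y,y)/2\<close> that is linear along the positive space.\<close>
  define k where "k y = Sform S (P a) y - Sform S (P a) (P a) / 2 + Sform S (y - P y) (y - P y) / 2" for y
  have k_le: "k y \<le> Sform S y y / 2" for y
  proof -
    have "Sform S y y / 2 - k y = Sform S (P (y - a)) (P (y - a)) / 2"
      unfolding k_def Sform_split[of y y] Sform_P_left[of a y] P_diff
      by (simp add: Sform.diff_left Sform.diff_right Sform_sym[of "P y" "P a"] field_simps)
    then show ?thesis using Sform_P_nonneg[of "y - a"] by simp
  qed
  define K where "K = {(y, r). r < k y}"
  have k_concave: "u * k x + v * k y \<le> k (u *\<^sub>R x + v *\<^sub>R y)" if "u \<ge> 0" "v \<ge> 0" "u + v = 1" for u v x y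
  proof -
    let ?q = "\<lambda>y. y - P y"
    have lin: "?q (u *\<^sub>R x + v *\<^sub>R y) = u *\<^sub>R ?q x + v *\<^sub>R ?q y"
      by (simp add: P_add P_scale algebra_simps)
    have "Sform S (?q y - ?q x) (?q y - ?q x) \<le> 0"
      by (rule Sform_ker_P_nonpos) (simp add: P_diff P_idem)
    then have "u * v * Sform S (?q y - ?q x) (?q y - ?q x) \<le> 0"
      using that by (simp add: mult_nonneg_nonpos)
    then have "u * Sform S (?q x) (?q x) + v * Sform S (?q y) (?q y)
      \<le> Sform S (?q (u *\<^sub>R x + v *\<^sub>R y)) (?q (u *\<^sub>R x + v *\<^sub>R y))"
      unfolding lin Sform_convex_combination[OF that(3)] by simp
    moreover have "u * (Sform S (P a) (P a) / 2) + v * (Sform S (P a) (P a) / 2) = Sform S (P a) (P a) / 2"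
      using that(3) by (metis distrib_right mult_1)
    ultimately show ?thesis unfolding k_def
      by (simp add: Sform.add_right Sform.scaleR_right algebra_simps)
  qed
  have "convex K"
    unfolding convex_def K_def
  proof (clarsimp)
    fix x y :: "real^'n" and r s u v :: real
    assume *: "r < k x" "s < k y" "0 \<le> u" "0 \<le> v" "u + v = 1"
    have "u * r + v * s < u * k x + v * k y"
    proof (cases "u = 0")
      case False
      then have "u * r < u * k x" "v * s \<le> v * k y" using * by (auto intro: mult_left_mono)
      then show ?thesis by linarith
    qed (use * in auto)
    then show "u * r + v * s < k (u *\<^sub>R x + v *\<^sub>R y)" using k_concave[OF *(3-5), of x y] by linarith
  qed
  moreover have "K \<noteq> {}"
    using lt_ex[of "k 0"] by (auto simp: K_def)
  moreover have "K \<inter> E = {}"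
  proof -
    have False if "(y, r) \<in> K" "(y, r) \<in> E" for y r
      using above[OF that(2)] k_le[of y] that(1) by (simp add: K_def)
    then show ?thesis by fast
  qed
  ultimately obtain w b where w: "w \<noteq> 0" "\<forall>p\<in>K. w \<bullet> p \<le> b" "\<forall>p\<in>E. b \<le> w \<bullet> p"
    using separating_hyperplane_sets[of K E] E by blast
  obtain n s where "w = (n, s)" by fastforce
  with w have ns: "(n, s) \<noteq> 0"
    and lo: "\<And>y r. r < k y \<Longrightarrow> n \<bullet> y + s * r \<le> b"
    and hi: "\<And>y r. (y, r) \<in> E \<Longrightarrow> n \<bullet> y + s * r \<ge> b"
    by (force simp: K_def inner_prod_def)+
  \<comment> \<open>The hypograph reaches down to minus infinity, which a negative vertical
    coefficient would contradict.\<close>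
  have s_nonneg: "s \<ge> 0"
  proof (rule ccontr)
    assume "\<not> s \<ge> 0"
    define r where "r = min (k 0 - 1) ((b + 1) / s)"
    have "s * r \<ge> s * ((b + 1) / s)"
      using \<open>\<not> s \<ge> 0\<close> by (intro mult_left_mono_neg) (auto simp: r_def)
    then have "s * r \<ge> b + 1" using \<open>\<not> s \<ge> 0\<close> by simp
    moreover have "s * r \<le> b" using lo[of r 0] by (simp add: r_def min_less_iff_disj)
    ultimately show False by simp
  qed
  \<comment> \<open>A vertical hyperplane is impossible: \<open>k\<close> is finite everywhere, so
    \<open>n \<bullet> y\<close> would be bounded above on the whole space.\<close>
  have "s \<noteq> 0"
  proof
    assume s0: "s = 0"
    have bd: "n \<bullet> y \<le> b" for y using lo[of "k y - 1" y] s0 by simp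
    have "n = 0"
    proof (rule ccontr)
      assume "n \<noteq> 0"
      then show False using bd[of "((b + 1) / (n \<bullet> n)) *\<^sub>R n"] by simp
    qed
    then show False using ns s0 by (simp add: zero_prod_def)
  qed
  then have s: "s > 0" using s_nonneg by simp
  \<comment> \<open>Passes from the strict hypograph to its boundary.\<close>
  have lo': "n \<bullet> y + s * k y \<le> b" for y
  proof (rule field_le_epsilon)
    fix e :: real assume "e > 0"
    have "n \<bullet> y + s * (k y - e / s) \<le> b"
      using s \<open>e > 0\<close> by (intro lo) simp
    then show "n \<bullet> y + s * k y \<le> b + e" using s by (simp add: algebra_simps)
  qed
  obtain z where z: "\<And>y. Sform S z y = (- n /\<^sub>R s) \<bullet> y" using nondeg by blast
  define \<beta> where "\<beta> = b / s"
  have z_lo: "k y \<le> Sform S z y + \<beta>" for y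
    using lo'[of y] s by (simp add: z \<beta>_def field_simps)
  have z_hi: "Sform S z y + \<beta> \<le> r" if "(y, r) \<in> E" for y r
    using hi[OF that] s by (simp add: z \<beta>_def field_simps)
  \<comment> \<open>Along the line spanned by \<open>p\<close> the majorant minus \<open>k\<close>
    is affine in the parameter \<tau>, with slope \<open>- Sform S p p\<close>, and bounded below,
    so this slope must vanish.\<close>
  have Pz: "P z = P a"
  proof -
    define p where "p = P (a - z)"
    have Pp: "P p = p" by (simp add: p_def P_idem)
    have le: "\<tau> * Sform S p p \<le> \<beta> + Sform S (P a) (P a) / 2" for \<tau>
    proof -
      have "k (\<tau> *\<^sub>R p) \<le> Sform S z (\<tau> *\<^sub>R p) + \<beta>" by (rule z_lo)
      moreover have "Sform S z p = Sform S (P z) p"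
        using Sform_P_left[of p z] Pp Sform_sym[of z p] Sform_sym[of "P z" p] by simp
      moreover have "Sform S p p = Sform S (P a) p - Sform S (P z) p"
        by (metis P_diff Sform.diff_left p_def)
      then have "\<tau> * Sform S p p = \<tau> * Sform S (P a) p - \<tau> * Sform S (P z) p"
        by (simp add: right_diff_distrib)
      ultimately show ?thesis
        unfolding k_def by (simp add: P_scale Pp Sform.scaleR_right Sform.zero_left algebra_simps)
    qed
    have nn: "Sform S p p \<ge> \<kappa> * (norm p)\<^sup>2" using P_pos[of p] Pp by simp
    have "p = 0"
    proof (rule ccontr)
      assume "p \<noteq> 0"
      then have "Sform S p p > 0" using nn \<kappa>_pos
        by (smt (verit) mult_pos_pos zero_less_norm_iff zero_less_power)
      then show False
        using le[of "(\<beta> + Sform S (P a) (P a) / 2 + 1) / Sform S p p"] by simp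
    qed
    then show ?thesis by (simp add: p_def P_diff)
  qed
  \<comment> \<open>The majorisation of \<open>k\<close> is evaluated at \<open>z - P z\<close>,
    where it yields exactly the constant term of the tangent at \<open>z\<close>. Hence that tangent
    lies below the separating affine function.\<close>
  have "- Sform S z z / 2 \<le> \<beta>"
  proof -
    let ?q = "z - P z"
    have q0: "P ?q = 0" by (simp add: P_diff P_idem)
    have "k ?q \<le> Sform S z ?q + \<beta>" by (rule z_lo)
    moreover have "Sform S (P a) ?q = 0" using P_orth Pz by metis
    moreover have "Sform S z ?q = Sform S ?q ?q" unfolding Sform_split[of z ?q] q0 by (simp add: Sform.zero_right)
    moreover have "Sform S z z = Sform S (P a) (P a) + Sform S ?q ?q" using Sform_split[of z z] Pz by simp
    ultimately show ?thesis unfolding k_def q0 by simp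
  qed
  then have "tangent S z y \<le> r" if "(y, r) \<in> E" for y r
    using z_hi[OF that] by (simp add: tangent_def)
  then show ?thesis using Pz by blast
qed

text \<open>Every convex majorant of \<open>S(y,y)/2\<close> dominates \<open>\<psi>\<^sub>H\<close> for some maximal \<open>H\<close>: take the points whose
  tangent lies below a maximal convex subset of the epigraph of \<open>S(y,y)/2\<close>.\<close>

lemma covers_dominates_maximal:
  assumes "covers S A"
  shows "\<exists>H\<in>MS S. (\<forall>a. \<exists>x\<in>H. P x = P a) \<and>
    (\<forall>y r. (\<forall>x\<in>A. tangent S x y \<le> r) \<longrightarrow> (\<forall>x\<in>H. tangent S x y \<le> r))"
proof -
  define C where "C = {(y, r). Sform S y y / 2 \<le> r}"
  define E0 where "E0 = {(y, r). \<forall>x\<in>A. tangent S x y \<le> r}"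
  define \<A> where "\<A> = {E. convex E \<and> E0 \<subseteq> E \<and> E \<subseteq> C}"
  have "convex E0"
    unfolding convex_def E0_def
  proof (clarsimp)
    fix x y z :: "real^'n" and r s u v :: real
    assume *: "\<forall>z\<in>A. tangent S z x \<le> r" "\<forall>z\<in>A. tangent S z y \<le> s" "0 \<le> u" "0 \<le> v" "u + v = 1" "z \<in> A"
    have "tangent S z (u *\<^sub>R x + v *\<^sub>R y) = u * tangent S z x + v * tangent S z y"
    proof -
      have u: "u = 1 - v" using \<open>u + v = 1\<close> by simp
      show ?thesis unfolding tangent_def Sform.add_right Sform.scaleR_right u
        by (simp add: field_simps)
    qed
    also have "\<dots> \<le> u * r + v * s" using * by (intro add_mono mult_left_mono) auto
    finally show "tangent S z (u *\<^sub>R x + v *\<^sub>R y) \<le> u * r + v * s" .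
  qed
  moreover have "E0 \<subseteq> C"
  proof clarify
    fix y r assume "(y, r) \<in> E0"
    moreover obtain x where "x \<in> A" "Sform S (y - x) (y - x) \<le> 0" using assms unfolding covers_def by blast
    ultimately show "(y, r) \<in> C" using tangent_eq[of x y] by (force simp: E0_def C_def)
  qed
  ultimately have "E0 \<in> \<A>" by (simp add: \<A>_def)
  have "\<exists>E\<in>\<A>. \<forall>X\<in>\<A>. E \<subseteq> X \<longrightarrow> X = E"
  proof (rule subset_Zorn_nonempty)
    show "\<A> \<noteq> {}" using \<open>E0 \<in> \<A>\<close> by blast
    fix \<C> assume ne: "\<C> \<noteq> {}" and ch: "subset.chain \<A> \<C>"
    have "convex (\<Union>\<C>)"
      unfolding convex_def
    proof (intro ballI allI impI)
      fix x y u v assume *: "x \<in> \<Union>\<C>" "y \<in> \<Union>\<C>" "0 \<le> u" "0 \<le> (v::real)" "u + v = 1"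
      then obtain D where "D \<in> \<C>" "x \<in> D" "y \<in> D"
        using ch unfolding subset.chain_def by blast
      moreover have "convex D" using ch \<open>D \<in> \<C>\<close> by (auto simp: subset.chain_def \<A>_def)
      ultimately show "u *\<^sub>R x + v *\<^sub>R y \<in> \<Union>\<C>" using * by (meson UnionI convexD)
    qed
    then show "\<Union>\<C> \<in> \<A>"
      using ch ne unfolding subset.chain_def \<A>_def by blast
  qed
  then obtain E where E: "E \<in> \<A>" and max: "\<And>X. X \<in> \<A> \<Longrightarrow> E \<subseteq> X \<Longrightarrow> X = E" by blast
  have cE: "convex E" and E0: "E0 \<subseteq> E" and EC: "\<And>y r. (y, r) \<in> E \<Longrightarrow> Sform S y y / 2 \<le> r"
    using E by (auto simp: \<A>_def C_def)
  \<comment> \<open>\<open>E0\<close> is empty when no finite value bounds the tangents of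
    \<open>A\<close>; maximality still keeps \<open>E\<close> nonempty, since the single point
    \<open>(0, 0)\<close> is admissible.\<close>
  have "E \<noteq> {}"
  proof
    assume "E = {}"
    then have "{(0, 0)} \<in> \<A>" using E by (auto simp: \<A>_def C_def Sform.zero_left)
    then show False using max[of "{(0,0)}"] \<open>E = {}\<close> by blast
  qed
  define H where "H = {x. \<forall>(y, r)\<in>E. tangent S x y \<le> r}"
  have full: "\<exists>x\<in>H. P x = P a" for a
    using exists_tangent_below[OF cE \<open>E \<noteq> {}\<close> EC, of a] by (auto simp: H_def)
  \<comment> \<open>Adjoining the point of the graph of \<open>c\<close> over \<open>x\<close> keeps
    the convex hull inside the epigraph, because the tangent at \<open>x\<close> lies below
    \<open>E\<close>. Maximality of \<open>E\<close> then forces the point into \<open>E\<close>,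
    and monotonicity of \<open>H\<close> follows by evaluating the other tangents there.\<close>
  have H_in_E: "(x, Sform S x x / 2) \<in> E" if "x \<in> H" for x
  proof -
    let ?p = "(x, Sform S x x / 2)"
    have "q \<in> C" if "q \<in> convex hull (insert ?p E)" for q
    proof -
      obtain u v w where uv: "u \<ge> 0" "v \<ge> 0" "u + v = 1" and w: "w \<in> E" and q: "q = u *\<^sub>R ?p + v *\<^sub>R w"
        using \<open>q \<in> _\<close> unfolding convex_hull_insert[OF \<open>E \<noteq> {}\<close>] convex_hull_eq[THEN iffD2, OF cE] by blast
      obtain y r where yr: "w = (y, r)" by fastforce
      let ?D = "Sform S (y - x) (y - x)"
      have r1: "Sform S y y / 2 \<le> r" using EC w yr by blast
      have r2: "Sform S y y / 2 - ?D / 2 \<le> r"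
        using \<open>x \<in> H\<close> w unfolding yr H_def tangent_eq by blast
      \<comment> \<open>Averaging the tangent bound and the epigraph bound with weights
        \<open>u\<close> and \<open>v\<close> produces precisely the defect in the convex
        combination formula for \<open>c\<close>.\<close>
      have "u * (Sform S y y / 2 - ?D / 2) + v * (Sform S y y / 2) \<le> u * r + v * r"
        by (intro add_mono mult_left_mono r1 r2 uv)
      also have "\<dots> = r" using uv by (metis distrib_right mult_1)
      finally have "(u + v) * (Sform S y y / 2) - u * ?D / 2 \<le> r" by (simp add: algebra_simps)
      then have "Sform S y y / 2 - u * ?D / 2 \<le> r" using uv by simp
      then have "v * (Sform S y y / 2 - u * ?D / 2) \<le> v * r" using uv by (intro mult_left_mono)
      then show ?thesis
        unfolding q yr C_def by (simp add: Sform_convex_combination[OF uv(3)] algebra_simps add_divide_distrib diff_divide_distrib)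
    qed
    moreover have sub: "insert ?p E \<subseteq> convex hull (insert ?p E)" by (rule hull_subset)
    ultimately have "convex hull (insert ?p E) \<in> \<A>"
      using E0 by (auto simp: \<A>_def)
    then show ?thesis using max sub by blast
  qed
  have "S_monotone S H"
    unfolding S_monotone_def
  proof (intro ballI)
    fix x y assume "x \<in> H" "y \<in> H"
    then have "tangent S y x \<le> Sform S x x / 2" using H_in_E[of x] unfolding H_def by blast
    then show "0 \<le> Sform S (x - y) (x - y)" unfolding tangent_eq by simp
  qed
  then have "H \<in> MS S" using full by (rule monotone_full_maximal)
  moreover have "tangent S x y \<le> r" if "\<forall>x\<in>A. tangent S x y \<le> r" "x \<in> H" for x y r
    using that E0 unfolding H_def E0_def by blast
  ultimately show ?thesis using full by blast
qed

lemma tangent_le_of_monotone: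
  assumes "S_monotone S G" "x \<in> G" "y \<in> G"
  shows "tangent S x y \<le> Sform S y y / 2"
  using assms unfolding tangent_eq S_monotone_def by simp

text \<open>The domination theorem is applied to \<open>G\<close> itself. On \<open>G\<close> its
  own tangents stay below \<open>c\<close>, hence so do those of the dominated set \<open>H\<close>;
  thus the union of \<open>G\<close> and \<open>H\<close> is monotone, and maximality puts the full
  set \<open>H\<close> inside \<open>G\<close>.\<close>

lemma maximal_full:
  assumes "G \<in> MS S"
  shows "\<exists>x\<in>G. P x = P a"
proof -
  have mono: "S_monotone S G" and max: "\<And>H. S_monotone S H \<Longrightarrow> G \<subseteq> H \<Longrightarrow> H = G"
    using assms by (auto simp: MS_def maximal_S_monotone_def)
  obtain H where H: "H \<in> MS S" "\<And>a. \<exists>x\<in>H. P x = P a"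
    and dom: "\<And>y r x. (\<forall>x\<in>G. tangent S x y \<le> r) \<Longrightarrow> x \<in> H \<Longrightarrow> tangent S x y \<le> r"
    using covers_dominates_maximal[OF maximal_covers[OF assms]] by blast
  have mH: "S_monotone S H" using H by (auto simp: MS_def maximal_S_monotone_def)
  have cross: "0 \<le> Sform S (y - x) (y - x)" if "y \<in> G" "x \<in> H" for x y
    using dom[OF _ \<open>x \<in> H\<close>, of y "Sform S y y / 2"] tangent_le_of_monotone[OF mono _ \<open>y \<in> G\<close>] tangent_eq[of x y]
    by simp
  have swap: "Sform S (x - y) (x - y) = Sform S (y - x) (y - x)" for x y
    using Sform.minus_left[of S "y - x" "x - y"] Sform.minus_right[of S "y - x" "y - x"] by simp
  have "S_monotone S (G \<union> H)"
    unfolding S_monotone_def using mono[unfolded S_monotone_def] mH[unfolded S_monotone_def] cross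
    by (metis UnE swap)
  then have "G \<union> H = G" using max by blast
  then show ?thesis using H(2)[of a] by blast
qed

end

section \<open>Perturbations of maximal sets\<close>

context sign_split
begin

lemma MS_monotone: "G \<in> MS S \<Longrightarrow> S_monotone S G"
  by (simp add: MS_def maximal_S_monotone_def)

text \<open>Nonnegativity of \<open>S\<close> on a difference bounds its negative component by its
  positive one, so a monotone set is a Lipschitz graph over its projection. In \<open>L\<close>, the
  1 accounts for the positive component and the root for the negative one.\<close>

lemma monotone_norm_le:
  "\<exists>L>0. \<forall>G x y. S_monotone S G \<longrightarrow> x \<in> G \<longrightarrow> y \<in> G \<longrightarrow> norm (x - y) \<le> L * norm (P x - P y)"
proof -
  obtain K where K: "K > 0" "\<And>a b. norm (Sform S a b) \<le> norm a * norm b * K"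
    using Sform.pos_bounded by blast
  define L where "L = 1 + sqrt (K / \<kappa>)"
  have "L > 0" using K \<kappa>_pos by (simp add: L_def add_pos_nonneg)
  moreover have "norm (x - y) \<le> L * norm (P x - P y)" if "S_monotone S G" "x \<in> G" "y \<in> G" for G x y
  proof -
    let ?d = "x - y"
    have "0 \<le> Sform S ?d ?d" using that by (auto simp: S_monotone_def)
    also have "\<dots> = Sform S (P ?d) (P ?d) + Sform S (?d - P ?d) (?d - P ?d)" by (rule Sform_split)
    also have "\<dots> \<le> K * (norm (P ?d))\<^sup>2 - \<kappa> * (norm (?d - P ?d))\<^sup>2"
      using K(2)[of "P ?d" "P ?d"] P_neg[of ?d] by (simp add: power2_eq_square mult.commute)
    finally have "(norm (?d - P ?d))\<^sup>2 \<le> K / \<kappa> * (norm (P ?d))\<^sup>2"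
      using \<kappa>_pos by (simp add: field_simps)
    then have "norm (?d - P ?d) \<le> sqrt (K / \<kappa> * (norm (P ?d))\<^sup>2)" by (rule real_le_rsqrt)
    then have "norm (?d - P ?d) \<le> sqrt (K / \<kappa>) * norm (P ?d)" unfolding real_sqrt_mult by simp
    then have "norm ?d \<le> norm (P ?d) + sqrt (K / \<kappa>) * norm (P ?d)"
      using norm_triangle_sub[of ?d "P ?d"] by linarith
    then show ?thesis by (simp add: L_def P_diff algebra_simps)
  qed
  ultimately show ?thesis by blast
qed

text \<open>For maximal \<open>G\<close> this is the inverse of \<open>P\<close> on \<open>G\<close>
  precomposed with \<open>P\<close>; being defined on the whole space, it can enter continuity and
  measurability arguments without a subspace.\<close>

definition sel :: "(real^'n) set \<Rightarrow> real^'n \<Rightarrow> real^'n" where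
  "sel G a = (SOME x. x \<in> G \<and> P x = P a)"

lemma sel_in: "G \<in> MS S \<Longrightarrow> sel G a \<in> G" and P_sel: "G \<in> MS S \<Longrightarrow> P (sel G a) = P a"
  unfolding sel_def using someI_ex[of "\<lambda>x. x \<in> G \<and> P x = P a"] maximal_full[of G a] by blast+

lemma bounded_linear_P: "bounded_linear P"
  using linear_P by (rule linear_conv_bounded_linear[THEN iffD1])

lemma sel_lipschitz:
  assumes "G \<in> MS S"
  obtains L where "L-lipschitz_on UNIV (sel G)"
proof -
  obtain L where L: "L > 0"
    "\<And>G x y. S_monotone S G \<Longrightarrow> x \<in> G \<Longrightarrow> y \<in> G \<Longrightarrow> norm (x - y) \<le> L * norm (P x - P y)"
    using monotone_norm_le by blast
  obtain B where B: "B > 0" "\<And>x. norm (P x) \<le> norm x * B"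
    using bounded_linear.pos_bounded[OF bounded_linear_P] by blast
  have "(L * B)-lipschitz_on UNIV (sel G)"
  proof (rule lipschitz_onI)
    fix a b
    have "dist (sel G a) (sel G b) \<le> L * norm (P a - P b)"
      using L(2)[OF MS_monotone[OF assms] sel_in[OF assms] sel_in[OF assms], of a b]
      by (simp add: dist_norm P_sel[OF assms])
    also have "\<dots> \<le> L * (norm (a - b) * B)"
      using L(1) B(2)[of "a - b"] by (simp add: P_diff)
    finally show "dist (sel G a) (sel G b) \<le> L * B * dist a b" by (simp add: dist_norm ac_simps)
  qed (use L B in auto)
  then show thesis by (rule that)
qed

lemma continuous_sel:
  assumes "G \<in> MS S" shows "continuous_on A (sel G)"
  using sel_lipschitz[OF assms] lipschitz_on_continuous_on continuous_on_subset by (metis subset_UNIV)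

lemma norm_sel_le:
  assumes "G \<in> MS S"
  obtains L where "\<And>a. norm (sel G a) \<le> L * (1 + norm a)"
proof -
  obtain L where L: "L-lipschitz_on UNIV (sel G)" by (rule sel_lipschitz[OF assms])
  have "norm (sel G a) \<le> (L + norm (sel G 0)) * (1 + norm a)" for a
  proof -
    have "norm (sel G a) \<le> norm (sel G 0) + L * norm a"
      using lipschitz_onD[OF L, of a 0] norm_triangle_sub[of "sel G a" "sel G 0"] by (simp add: dist_norm)
    also have "\<dots> \<le> (L + norm (sel G 0)) * (1 + norm a)"
      using lipschitz_on_nonneg[OF L] by (simp add: algebra_simps)
    finally show ?thesis .
  qed
  then show thesis by (rule that)
qed

lemma sel_eq_iff:
  assumes "G \<in> MS S" shows "sel G x = x \<longleftrightarrow> x \<in> G"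
proof
  assume "x \<in> G"
  obtain L where L: "L > 0"
    "\<And>G x y. S_monotone S G \<Longrightarrow> x \<in> G \<Longrightarrow> y \<in> G \<Longrightarrow> norm (x - y) \<le> L * norm (P x - P y)"
    using monotone_norm_le by blast
  then show "sel G x = x"
    using L(2)[OF MS_monotone[OF assms] sel_in[OF assms] \<open>x \<in> G\<close>, of x] by (simp add: P_sel[OF assms])
qed (use sel_in[OF assms, of x] in simp)

text \<open>\<open>G\<close> is the fixed point set of the continuous map
  \<open>sel G\<close>.\<close>

lemma closed_maximal:
  assumes "G \<in> MS S" shows "closed G"
proof -
  have "G = {x. sel G x = x}" using sel_eq_iff[OF assms] by blast
  moreover have "closed {x. sel G x = x}"
    by (rule closed_Collect_eq) (use continuous_sel[OF assms] in auto)
  ultimately show ?thesis by simp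
qed

text \<open>It suffices that some moved point has the same projection as \<open>y\<close>, since
  \<open>S\<close> is nonpositive on the kernel of \<open>P\<close>. Boundedness of \<phi> confines
  the corresponding fixed point problem to a ball.\<close>

lemma covers_perturbed:
  assumes G: "G \<in> MS S" and cont: "continuous_on UNIV \<phi>" and bd: "\<And>x. norm (\<phi> x) \<le> C"
    and t: "t \<ge> 0" and e: "e \<ge> 0"
  shows "covers S ((\<lambda>x. x + t *\<^sub>R (\<phi> x + e *\<^sub>R P x)) ` G)"
  unfolding covers_def
proof
  fix y
  \<comment> \<open>Writing \<open>a\<close> for the projection of the point to be found, requiring
    that its moved copy project to \<open>P y\<close> and solving for the linear occurrences of
    \<open>a\<close> gives \<open>a = T a\<close>.\<close>
  define T where "T a = (1 / (1 + t * e)) *\<^sub>R (P y - t *\<^sub>R P (\<phi> (sel G a)))" for a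
  obtain B where B: "B > 0" "\<And>x. norm (P x) \<le> norm x * B"
    using bounded_linear.pos_bounded[OF bounded_linear_P] by blast
  have te: "1 + t * e \<ge> 1" using t e by simp
  define R where "R = norm (P y) + t * (C * B)"
  have T_le: "norm (T a) \<le> R" for a
  proof -
    have "norm (P (\<phi> (sel G a))) \<le> C * B"
      using B bd by (meson mult_right_mono less_imp_le order_trans)
    then have "norm (P y - t *\<^sub>R P (\<phi> (sel G a))) \<le> R"
      unfolding R_def using t norm_triangle_ineq4[of "P y" "t *\<^sub>R P (\<phi> (sel G a))"]
      by (smt (verit) mult_left_mono norm_scaleR)
    moreover have "norm (T a) \<le> norm (P y - t *\<^sub>R P (\<phi> (sel G a)))"
      unfolding T_def using te by (simp add: divide_le_eq mult_right_le_one_le mult_le_cancel_left1)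
    ultimately show ?thesis by linarith
  qed
  have "R \<ge> 0" using T_le[of 0] norm_ge_zero order_trans by blast
  have "continuous_on (cball 0 R) T"
    unfolding T_def
    by (intro continuous_intros bounded_linear.continuous_on[OF bounded_linear_P]
        continuous_on_compose2[OF cont] continuous_sel[OF G]) auto
  then obtain a where a: "T a = a"
    using brouwer[of "cball 0 R" T] T_le \<open>R \<ge> 0\<close> by auto
  define x where "x = sel G a"
  have "P a = a"
    using arg_cong[OF a, of P] a by (simp add: T_def P_scale P_diff P_idem)
  then have Px: "P x = a" by (simp add: x_def P_sel[OF G])
  have "(1 + t * e) *\<^sub>R a = P y - t *\<^sub>R P (\<phi> x)"
  proof -
    have "(1 + t * e) *\<^sub>R T a = P y - t *\<^sub>R P (\<phi> x)" unfolding T_def x_def using te by simp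
    then show ?thesis using a by simp
  qed
  then have "P (y - (x + t *\<^sub>R (\<phi> x + e *\<^sub>R P x))) = 0"
    by (simp add: P_diff P_add P_scale P_idem Px \<open>P a = a\<close> algebra_simps)
  then have "Sform S (y - (x + t *\<^sub>R (\<phi> x + e *\<^sub>R P x))) (y - (x + t *\<^sub>R (\<phi> x + e *\<^sub>R P x))) \<le> 0"
    by (rule Sform_ker_P_nonpos)
  moreover have "x \<in> G" by (simp add: x_def sel_in[OF G])
  ultimately show "\<exists>z\<in>(\<lambda>x. x + t *\<^sub>R (\<phi> x + e *\<^sub>R P x)) ` G. Sform S (y - z) (y - z) \<le> 0" by blast
qed

lemma tangent_perturbed:
  "tangent S (x + t *\<^sub>R w) y = tangent S x y + t * Sform S w (y - x) - t\<^sup>2 * Sform S w w / 2"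
  by (simp add: tangent_def Sform.add_left Sform.add_right Sform.diff_left Sform.diff_right
      Sform.scaleR_left Sform.scaleR_right Sform_sym[of x w] power2_eq_square field_simps)

text \<open>The square is completed around half of \<open>P y\<close>. The bound is independent of
  \<open>x\<close>, which makes the cost of the extra velocity integrable.\<close>

lemma Sform_P_diff_le: "Sform S (P x) (y - x) \<le> Sform S (P y) (P y) / 4"
proof -
  have "0 \<le> Sform S (P (x - (1/2) *\<^sub>R y)) (P (x - (1/2) *\<^sub>R y))" by (rule Sform_P_nonneg)
  also have "\<dots> = Sform S (P x) (P x) - Sform S (P x) (P y) + Sform S (P y) (P y) / 4"
    by (simp add: P_diff P_scale Sform.diff_left Sform.diff_right Sform.scaleR_left Sform.scaleR_right
        Sform_sym[of "P y" "P x"] field_simps)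
  finally show ?thesis
    using Sform_P_left[of x "y - x"] by (simp add: P_diff Sform.diff_right)
qed

definition velocity :: "(real^'n \<Rightarrow> real^'n) \<Rightarrow> real \<Rightarrow> real^'n \<Rightarrow> real^'n" where
  "velocity \<phi> e x = \<phi> x + e *\<^sub>R P x"

text \<open>These bounds will dominate the difference quotients, so none of them may depend on
  \<open>x\<close>. The first rests on the compact support of \<phi>, the third on completing the
  square.\<close>

lemma velocity_bounds:
  assumes bd: "\<And>x. norm (\<phi> x) \<le> C" and supp: "\<And>x. norm x > R \<Longrightarrow> \<phi> x = 0"
  obtains D where "D > 0"
    "\<And>x y. \<bar>Sform S (\<phi> x) (y - x)\<bar> \<le> D * (1 + norm y)"
    "\<And>x e. - Sform S (velocity \<phi> e x) (velocity \<phi> e x) / 2 \<le> D"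
    "\<And>x y. Sform S (P x) (y - x) \<le> D * (norm y)\<^sup>2"
proof -
  obtain K where K: "K > 0" "\<And>a b. norm (Sform S a b) \<le> norm a * norm b * K"
    using Sform.pos_bounded by blast
  obtain B where B: "B > 0" "\<And>x. norm (P x) \<le> norm x * B"
    using bounded_linear.pos_bounded[OF bounded_linear_P] by blast
  have C0: "C \<ge> 0" using bd[of 0] norm_ge_zero order_trans by blast
  define D1 where "D1 = C * K * (1 + \<bar>R\<bar>)"
  define D2 where "D2 = (C * (1 + B))\<^sup>2 * K / 2"
  define D3 where "D3 = B\<^sup>2 * K / 4"
  have D0: "D1 \<ge> 0" "D2 \<ge> 0" "D3 \<ge> 0" using C0 K B by (auto simp: D1_def D2_def D3_def)
  have b1: "\<bar>Sform S (\<phi> x) (y - x)\<bar> \<le> D1 * (1 + norm y)" for x y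
  proof (cases "norm x > R")
    case True
    then show ?thesis using supp D0 by (simp add: Sform.zero_left)
  next
    case False
    have "\<bar>Sform S (\<phi> x) (y - x)\<bar> \<le> norm (\<phi> x) * norm (y - x) * K" using K(2) by simp
    also have "\<dots> \<le> C * ((1 + \<bar>R\<bar>) * (1 + norm y)) * K"
    proof (intro mult_right_mono mult_mono bd C0)
      show "norm (y - x) \<le> (1 + \<bar>R\<bar>) * (1 + norm y)"
      proof -
        have "norm x \<le> \<bar>R\<bar>" "0 \<le> \<bar>R\<bar> * norm y" using False by auto
        then show ?thesis unfolding distrib_left distrib_right using norm_triangle_ineq4[of y x] by linarith
      qed
    qed (use K in auto)
    finally show ?thesis by (simp add: D1_def ac_simps)
  qed
  have b2: "- Sform S (velocity \<phi> e x) (velocity \<phi> e x) / 2 \<le> D2" for e x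
  proof -
    let ?q = "\<phi> x - P (\<phi> x)"
    \<comment> \<open>The extra velocity lies in the positive space and drops out of the negative
      component, so the bound is uniform in \<open>e\<close> and \<open>x\<close>.\<close>
    have eq: "velocity \<phi> e x - P (velocity \<phi> e x) = ?q" by (simp add: velocity_def P_add P_scale P_idem)
    have "norm ?q \<le> norm (\<phi> x) + norm (\<phi> x) * B"
      using norm_triangle_ineq4[of "\<phi> x" "P (\<phi> x)"] B(2)[of "\<phi> x"] by linarith
    also have "\<dots> \<le> C * (1 + B)" using bd[of x] B by (simp add: distrib_left add_mono mult_right_mono)
    finally have q: "norm ?q \<le> C * (1 + B)" .
    have "- Sform S ?q ?q \<le> norm ?q * norm ?q * K" using K(2)[of ?q ?q] by simp
    also have "\<dots> \<le> (C * (1 + B)) * (C * (1 + B)) * K"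
      using q K C0 B by (intro mult_right_mono mult_mono) auto
    finally have "- Sform S ?q ?q \<le> (C * (1 + B))\<^sup>2 * K" by (simp add: power2_eq_square)
    then show ?thesis
      using Sform_split[of "velocity \<phi> e x" "velocity \<phi> e x"] Sform_P_nonneg[of "velocity \<phi> e x"]
      unfolding eq D2_def by simp
  qed
  have b3: "Sform S (P x) (y - x) \<le> D3 * (norm y)\<^sup>2" for x y
  proof -
    have "Sform S (P y) (P y) \<le> norm (P y) * norm (P y) * K" using K(2)[of "P y" "P y"] by simp
    also have "\<dots> \<le> (norm y * B) * (norm y * B) * K"
      using B K by (intro mult_right_mono mult_mono) auto
    finally show ?thesis using Sform_P_diff_le[of x y] by (simp add: D3_def power2_eq_square ac_simps)
  qed
  show thesis
  proof (rule that[of "1 + D1 + D2 + D3"])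
    show "1 + D1 + D2 + D3 > 0" using D0 by simp
    show "\<bar>Sform S (\<phi> x) (y - x)\<bar> \<le> (1 + D1 + D2 + D3) * (1 + norm y)" for x y
      using b1 by (rule order_trans) (use D0 in \<open>auto intro!: mult_right_mono\<close>)
    show "- Sform S (velocity \<phi> e x) (velocity \<phi> e x) / 2 \<le> 1 + D1 + D2 + D3" for x e
      using b2[of e x] D0 by linarith
    show "Sform S (P x) (y - x) \<le> (1 + D1 + D2 + D3) * (norm y)\<^sup>2" for x y
      using b3 by (rule order_trans) (use D0 in \<open>auto intro!: mult_right_mono\<close>)
  qed
qed

end

section \<open>The projection onto a maximal set\<close>

lemma PG_iff: "x \<in> PG S G y \<longleftrightarrow> x \<in> G \<and> (\<forall>z\<in>G. tangent S z y \<le> tangent S x y)"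
  by (simp add: PG_def tangent_def)

lemma psi_le_iff: "psi S G y \<le> ereal r \<longleftrightarrow> (\<forall>x\<in>G. tangent S x y \<le> r)"
  by (simp add: psi_def SUP_le_iff tangent_def)

lemma continuous_tangent [continuous_intros]:
  "continuous_on A f \<Longrightarrow> continuous_on A g \<Longrightarrow> continuous_on A (\<lambda>x. tangent S (f x) (g x))"
  unfolding tangent_def by (intro continuous_intros Sform.continuous_on) auto

lemma tendsto_tangent:
  "(f \<longlongrightarrow> a) F \<Longrightarrow> (g \<longlongrightarrow> b) F \<Longrightarrow> ((\<lambda>x. tangent S (f x) (g x)) \<longlongrightarrow> tangent S a b) F"
  unfolding tangent_def by (intro tendsto_intros Sform.tendsto) auto

context sign_split
begin

text \<open>The component \<open>e P x\<close> of the velocity pushes points at infinity down at infinite speed, so that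
  only genuine maximisers matter for the one-sided derivative.\<close>

lemma perturbed_tangent_eventually_le:
  assumes G: "G \<in> MS S" and cont: "continuous_on UNIV \<phi>" and bd: "\<And>x. norm (\<phi> x) \<le> C"
    and supp: "\<And>x. norm x > R \<Longrightarrow> \<phi> x = 0" and e: "e > 0"
    and g: "\<And>x. x \<in> G \<Longrightarrow> tangent S x y \<le> g"
    and t: "\<And>n. 0 < t n" "t \<longlonglongrightarrow> 0"
    and L: "\<And>x. x \<in> PG S G y \<Longrightarrow> Sform S (velocity \<phi> e x) (y - x) < L"
  shows "\<forall>\<^sub>F n in sequentially. \<forall>x\<in>G. tangent S (x + t n *\<^sub>R velocity \<phi> e x) y \<le> g + t n * L"
proof (rule ccontr)
  assume *: "\<not> ?thesis"
  obtain r :: "nat \<Rightarrow> nat" where r: "strict_mono r"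
    and "\<And>n. \<not> (\<forall>x\<in>G. tangent S (x + t (r n) *\<^sub>R velocity \<phi> e x) y \<le> g + t (r n) * L)"
    using not_eventually_sequentiallyD[OF *] by blast
  then obtain x where xG: "\<And>n. x n \<in> G"
    and x: "\<And>n. tangent S (x n + t (r n) *\<^sub>R velocity \<phi> e (x n)) y > g + t (r n) * L"
    by (metis not_le)
  define s where "s = (\<lambda>n. t (r n))"
  have s: "\<And>n. 0 < s n" "s \<longlonglongrightarrow> 0"
    using t LIMSEQ_subseq_LIMSEQ[OF t(2) r] by (auto simp: s_def o_def)
  obtain D where D: "D > 0"
    "\<And>x y. \<bar>Sform S (\<phi> x) (y - x)\<bar> \<le> D * (1 + norm y)"
    "\<And>x e. - Sform S (velocity \<phi> e x) (velocity \<phi> e x) / 2 \<le> D"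
    "\<And>x y. Sform S (P x) (y - x) \<le> D * (norm y)\<^sup>2"
    using velocity_bounds[of \<phi> C R] bd supp by blast
  define v where "v n = Sform S (velocity \<phi> e (x n)) (y - x n)" for n
  have main: "g + s n * L < tangent S (x n) y + s n * v n + (s n)\<^sup>2 * D" for n
  proof -
    have "(s n)\<^sup>2 * (- Sform S (velocity \<phi> e (x n)) (velocity \<phi> e (x n)) / 2) \<le> (s n)\<^sup>2 * D"
      using D(3) e by (intro mult_left_mono) auto
    then show ?thesis using x[of n] unfolding tangent_perturbed v_def s_def by simp
  qed
  \<comment> \<open>Unmoved tangents do not exceed \<open>g\<close>, so the excess must come from
    the motion: the speed is at least \<open>L\<close> up to the second-order term.\<close>
  have v_lo: "L - s n * D < v n" for n
  proof -
    have "s n * L < s n * v n + (s n)\<^sup>2 * D" using main[of n] g[OF xG[of n]] by linarith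
    then have "s n * L < s n * (v n + s n * D)" by (simp add: power2_eq_square algebra_simps)
    then show ?thesis using s(1)[of n] by simp
  qed
  have v_eq: "v n = Sform S (\<phi> (x n)) (y - x n) + e * Sform S (P (x n)) (y - x n)" for n
    unfolding v_def velocity_def by (simp add: Sform.add_left Sform.scaleR_left)
  obtain K where K: "K > 0" "\<And>a b. norm (Sform S a b) \<le> norm a * norm b * K"
    using Sform.pos_bounded by blast
  \<comment> \<open>Here the extra velocity acts: it contributes a negative quadratic term in
    \<open>P (x n)\<close>. Together with \<open>v_lo\<close> this bounds the projections, and then
    the points themselves, because \<open>G\<close> is a Lipschitz graph.\<close>
  have v_hi: "v n \<le> D * (1 + norm y) + e * (norm (P (x n)) * (norm (P y) * K) - \<kappa> * (norm (P (x n)))\<^sup>2)" for n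
  proof -
    have "Sform S (P (x n)) (y - x n) \<le> norm (P (x n)) * (norm (P y) * K) - \<kappa> * (norm (P (x n)))\<^sup>2"
      using Sform_P_left[of "x n" "y - x n"] K(2)[of "P (x n)" "P y"] P_pos[of "x n"]
      by (simp add: P_diff Sform.diff_right ac_simps)
    then show ?thesis unfolding v_eq using D(2)[of "x n" y] e
      by (intro add_mono mult_left_mono) auto
  qed
  obtain s1 where s1: "\<And>n. s n \<le> s1"
    using convergent_imp_Bseq[OF convergentI[OF s(2)]] unfolding Bseq_def by (metis abs_le_iff real_norm_def)
  define \<mu> where "\<mu> = \<bar>(D * (1 + norm y) - L + s1 * D) / e\<bar>"
  have Px: "norm (P (x n)) \<le> 1 + (norm (P y) * K + \<mu>) / \<kappa>" for n
  proof -
    let ?p = "norm (P (x n))"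
    have "s n * D \<le> s1 * D" using s1 D(1) by simp
    then have "- (e * (?p * (norm (P y) * K) - \<kappa> * ?p\<^sup>2)) \<le> D * (1 + norm y) - L + s1 * D"
      using v_lo[of n] v_hi[of n] by linarith
    then have "\<kappa> * ?p\<^sup>2 - ?p * (norm (P y) * K) \<le> (D * (1 + norm y) - L + s1 * D) / e"
      using e by (simp add: field_simps)
    then have *: "\<kappa> * ?p\<^sup>2 - ?p * (norm (P y) * K) \<le> \<mu>" unfolding \<mu>_def by linarith
    show ?thesis
    proof (cases "?p \<le> 1")
      case True
      have "0 \<le> (norm (P y) * K + \<mu>) / \<kappa>" using K \<kappa>_pos by (simp add: \<mu>_def)
      then show ?thesis using True by linarith
    next
      case False
      have "\<mu> \<le> ?p * \<mu>" using False mult_right_mono[of 1 ?p \<mu>] by (simp add: \<mu>_def)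
      then have "?p * (\<kappa> * ?p) \<le> ?p * (norm (P y) * K + \<mu>)"
        using * by (simp add: power2_eq_square algebra_simps)
      then have "\<kappa> * ?p \<le> norm (P y) * K + \<mu>"
        by (rule mult_left_le_imp_le) (use False in linarith)
      then have "?p \<le> (norm (P y) * K + \<mu>) / \<kappa>" using \<kappa>_pos by (simp add: field_simps)
      then show ?thesis by simp
    qed
  qed
  have "bounded (range x)"
  proof -
    obtain N where N: "N > 0" "\<And>G x y. S_monotone S G \<Longrightarrow> x \<in> G \<Longrightarrow> y \<in> G \<Longrightarrow> norm (x - y) \<le> N * norm (P x - P y)"
      using monotone_norm_le by blast
    obtain \<rho> where \<rho>: "\<And>n. norm (P (x n)) \<le> \<rho>" using Px by blast
    have "norm (x n) \<le> norm (x 0) + N * (2 * \<rho>)" for n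
    proof -
      have "norm (x n - x 0) \<le> N * norm (P (x n) - P (x 0))"
        by (rule N(2)[OF MS_monotone[OF G] xG xG])
      also have "\<dots> \<le> N * (2 * \<rho>)"
        using N(1) \<rho>[of n] \<rho>[of 0] norm_triangle_ineq4[of "P (x n)" "P (x 0)"] by (intro mult_left_mono) linarith+
      finally show ?thesis using norm_triangle_sub[of "x n" "x 0"] by linarith
    qed
    then show ?thesis unfolding bounded_iff by blast
  qed
  then obtain l and q :: "nat \<Rightarrow> nat" where q: "strict_mono q" and lim: "(x \<circ> q) \<longlonglongrightarrow> l"
    using bounded_imp_convergent_subsequence by blast
  have lim_s: "(\<lambda>n. s (q n)) \<longlonglongrightarrow> 0" using LIMSEQ_subseq_LIMSEQ[OF s(2) q] by (simp add: o_def)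
  have lim_x: "(\<lambda>n. x (q n)) \<longlonglongrightarrow> l" using lim by (simp add: o_def)
  have lG: "l \<in> G" using closed_maximal[OF G] lim_x xG by (meson closed_sequentially)
  have lim_v: "(\<lambda>n. v (q n)) \<longlonglongrightarrow> Sform S (velocity \<phi> e l) (y - l)"
    unfolding v_def velocity_def
    by (intro Sform.tendsto tendsto_intros lim_x bounded_linear.tendsto[OF bounded_linear_P]
        continuous_on_tendsto_compose[OF cont]) auto
  \<comment> \<open>The limit point has speed at least \<open>L\<close>; the next estimate shows
    that its tangent attains \<open>g\<close>. It is therefore a maximiser that contradicts the
    strict bound \<open>L\<close>.\<close>
  have "L - 0 * D \<le> Sform S (velocity \<phi> e l) (y - l)"
  proof (rule LIMSEQ_le[OF _ lim_v])
    show "(\<lambda>n. L - s (q n) * D) \<longlonglongrightarrow> L - 0 * D" by (intro tendsto_intros lim_s)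
  qed (use v_lo less_imp_le in blast)
  moreover have "g + 0 * L - 0 * Sform S (velocity \<phi> e l) (y - l) - 0\<^sup>2 * D \<le> tangent S l y"
  proof (rule LIMSEQ_le[OF _ tendsto_tangent[OF lim_x tendsto_const]])
    show "(\<lambda>n. g + s (q n) * L - s (q n) * v (q n) - (s (q n))\<^sup>2 * D)
       \<longlonglongrightarrow> g + 0 * L - 0 * Sform S (velocity \<phi> e l) (y - l) - 0\<^sup>2 * D"
      by (intro tendsto_intros lim_s lim_v)
    have "g + s (q n) * L - s (q n) * v (q n) - (s (q n))\<^sup>2 * D \<le> tangent S (x (q n)) y" for n
      using main[of "q n"] by linarith
    then show "\<exists>N. \<forall>n\<ge>N. g + s (q n) * L - s (q n) * v (q n) - (s (q n))\<^sup>2 * D \<le> tangent S (x (q n)) y"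
      by blast
  qed
  then have "l \<in> PG S G y" using lG g unfolding PG_iff by force
  ultimately show False using L by force
qed

end

section \<open>Borel measurability of the projection and of its multivalued set\<close>

lemma borel_snd_closed:
  fixes C :: "('a::euclidean_space \<times> 'b::euclidean_space) set"
  assumes "closed C" shows "snd ` C \<in> sets borel"
proof -
  \<comment> \<open>A projection of a closed set need not be closed; cutting \<open>C\<close> into
    countably many compact pieces makes the image a countable union of closed sets.\<close>
  have "snd ` C = (\<Union>n::nat. snd ` (C \<inter> cball 0 (real n)))"
  proof -
    have "\<exists>n. p \<in> cball 0 (real n)" for p :: "'a \<times> 'b"
      using real_arch_simple[of "norm p"] by simp
    then show ?thesis by fast
  qed
  moreover have "closed (snd ` (C \<inter> cball 0 (real n)))" for n
    by (intro compact_imp_closed compact_continuous_image continuous_intros closed_Int_compact[OF assms] compact_cball)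
  ultimately show ?thesis by auto
qed

lemma closed_PG_graph:
  fixes G :: "(real^'n) set"
  assumes "closed G"
  shows "closed {p. fst p \<in> PG S G (snd p)}"
proof -
  have "{p. fst p \<in> PG S G (snd p)} = fst -` G \<inter> (\<Inter>z\<in>G. {p. tangent S z (snd p) \<le> tangent S (fst p) (snd p)})"
    by (auto simp: PG_iff)
  moreover have "closed (fst -` G :: ((real^'n) \<times> (real^'n)) set)"
    using assms by (intro closed_vimage_fst)
  moreover have "closed {p. tangent S z (snd p) \<le> tangent S (fst p) (snd p)}" for z
    by (intro closed_Collect_le continuous_intros)
  ultimately show ?thesis by (simp add: closed_INT closed_Int)
qed

lemma borel_PG_hits:
  fixes G :: "(real^'n) set"
  assumes "closed G" "closed C"
  shows "{y. PG S G y \<inter> C \<noteq> {}} \<in> sets borel"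
proof -
  have "{y. PG S G y \<inter> C \<noteq> {}} = snd ` ({p. fst p \<in> PG S G (snd p)} \<inter> fst -` C)"
    by (auto simp: image_iff disjoint_iff intro!: bexI[of _ "(_, _)"])
  also have "\<dots> \<in> sets borel"
    using assms by (intro borel_snd_closed closed_Int closed_PG_graph closed_vimage_fst)
  finally show ?thesis .
qed

lemma borel_Sigma_PG:
  fixes G :: "(real^'n) set"
  assumes "closed G"
  shows "Sigma_PG S G \<in> sets borel"
proof -
  define C where "C n = {p::((real^'n) \<times> (real^'n)) \<times> (real^'n).
     fst (fst p) \<in> PG S G (snd p) \<and> snd (fst p) \<in> PG S G (snd p) \<and> dist (fst (fst p)) (snd (fst p)) \<ge> 1 / real (Suc n)}" for n
  have "Sigma_PG S G = (\<Union>n. snd ` C n)"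
  proof (intro equalityI subsetI)
    fix y assume "y \<in> Sigma_PG S G"
    then obtain a b where ab: "a \<in> PG S G y" "b \<in> PG S G y" "a \<noteq> b"
      unfolding Sigma_PG_def by blast
    then obtain n where "1 / real (Suc n) < dist a b"
      using nat_approx_posE[of "dist a b"] by auto
    then have "((a, b), y) \<in> C n" using ab by (simp add: C_def)
    then show "y \<in> (\<Union>n. snd ` C n)" by force
  next
    fix y assume "y \<in> (\<Union>n. snd ` C n)"
    then obtain n a b where ab: "a \<in> PG S G y" "b \<in> PG S G y" "dist a b \<ge> 1 / real (Suc n)"
      by (auto simp: C_def)
    have "dist a b > 0" using ab(3) by (rule less_le_trans[rotated]) simp
    then have "a \<noteq> b" by simp
    then show "y \<in> Sigma_PG S G" using ab(1,2) unfolding Sigma_PG_def by force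
  qed
  moreover have "closed (C n)" for n
  proof -
    have "C n = (\<lambda>p. (fst (fst p), snd p)) -` {p. fst p \<in> PG S G (snd p)} \<inter>
       (\<lambda>p. (snd (fst p), snd p)) -` {p. fst p \<in> PG S G (snd p)} \<inter>
       {p. 1 / real (Suc n) \<le> dist (fst (fst p)) (snd (fst p))}"
      by (auto simp: C_def)
    also have "closed \<dots>"
      by (intro closed_Int closed_vimage closed_PG_graph assms continuous_intros closed_Collect_le)
    finally show ?thesis .
  qed
  ultimately show ?thesis by (auto intro!: borel_snd_closed)
qed

text \<open>Where no maximiser exists, the description operator returns one fixed unspecified
  vector. It does not depend on \<open>y\<close>, so it is harmless for Borel measurability.\<close>

definition PG_map :: "real^'n^'n \<Rightarrow> (real^'n) set \<Rightarrow> real^'n \<Rightarrow> real^'n" where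
  "PG_map S G y = (if y \<notin> Sigma_PG S G then (THE x. PG S G y = {x}) else 0)"

lemma PG_map_eq: "PG S G y \<noteq> {} \<Longrightarrow> y \<notin> Sigma_PG S G \<Longrightarrow> PG S G y = {PG_map S G y}"
  unfolding PG_map_def Sigma_PG_def by auto

lemma borel_measurable_PG_map:
  fixes G :: "(real^'n) set"
  assumes "closed G"
  shows "PG_map S G \<in> borel_measurable borel"
proof (rule borel_measurableI)
  fix U :: "(real^'n) set" assume "open U"
  define d where "d = (THE x::real^'n. {} = {x})"
  define N where "N = {y. PG S G y = {}}"
  define Sg where "Sg = Sigma_PG S G"
  have Sg: "Sg \<in> sets borel" unfolding Sg_def by (rule borel_Sigma_PG[OF assms])
  have N: "N \<in> sets borel"
  proof -
    have "N = - {y. PG S G y \<inter> UNIV \<noteq> {}}" by (auto simp: N_def)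
    then show ?thesis using borel_PG_hits[OF assms, of UNIV] borel_comp by simp
  qed
  have disj: "y \<notin> Sg" if "y \<in> N" for y using that by (simp add: N_def Sg_def Sigma_PG_def)
  have "PG_map S G -` (-U) = ({y. PG S G y \<inter> (-U) \<noteq> {}} - Sg) \<union> (if 0 \<in> -U then Sg else {}) \<union> (if d \<in> -U then N else {})"
    (is "?l = ?r")
  proof (intro set_eqI)
    fix y
    consider "y \<in> Sg" | "y \<in> N" "y \<notin> Sg" | "y \<notin> N" "y \<notin> Sg" by blast
    then show "y \<in> ?l \<longleftrightarrow> y \<in> ?r"
    proof cases
      case 1 then show ?thesis using disj by (auto simp: PG_map_def Sg_def)
    next
      case 2 then show ?thesis by (auto simp: PG_map_def Sg_def N_def d_def)
    next
      case 3 then show ?thesis using PG_map_eq[of S G y] by (auto simp: Sg_def N_def)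
    qed
  qed
  also have "\<dots> \<in> sets borel"
    using borel_PG_hits[OF assms, of "-U"] \<open>open U\<close> Sg N by auto
  finally have "- (PG_map S G -` (-U)) \<in> sets borel" by (rule borel_comp)
  then show "PG_map S G -` U \<inter> space borel \<in> sets borel" by (simp add: vimage_Compl)
qed

section \<open>Square-integrable martingale pairs\<close>

text \<open>The supremum may be uncountable, but a supremum of continuous functions has open strict
  superlevel sets.\<close>

lemma borel_measurable_psi [measurable]: "psi S G \<in> borel_measurable borel"
proof (rule borel_measurableI_greater)
  fix a :: ereal
  have "{y. a < psi S G y} = (\<Union>x\<in>G. {y. a < ereal (tangent S x y)})"
    by (auto simp: psi_def less_SUP_iff tangent_def)
  moreover have "open {y. a < ereal (tangent S x y)}" for x
    by (intro open_Collect_less continuous_intros)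
  ultimately show "{y\<in>space borel. a < psi S G y} \<in> sets borel" by (auto intro!: borel_open)
qed

lemma borel_measurable_Sform [measurable (raw)]:
  assumes "f \<in> borel_measurable N" "g \<in> borel_measurable N"
  shows "(\<lambda>\<omega>. Sform S (f \<omega>) (g \<omega>)) \<in> borel_measurable N"
  by (rule borel_measurable_continuous_Pair[OF assms]) (intro Sform.continuous_on continuous_intros)

lemma L2_measurable: "L2 N A \<Longrightarrow> A \<in> borel_measurable N"
  and L2_integrable_square: "L2 N A \<Longrightarrow> integrable N (\<lambda>\<omega>. (norm (A \<omega>))\<^sup>2)"
  by (auto simp: L2_def)

lemma L2_integrable_norm:
  assumes "prob_space N" "L2 N A" shows "integrable N (\<lambda>\<omega>. norm (A \<omega>))"
proof -
  interpret prob_space N by fact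
  have [measurable]: "A \<in> borel_measurable N" using assms(2) by (rule L2_measurable)
  show ?thesis
  proof (rule Bochner_Integration.integrable_bound)
    show "integrable N (\<lambda>\<omega>. 1 + (norm (A \<omega>))\<^sup>2)"
      using L2_integrable_square[OF assms(2)] by simp
    have "x \<le> 1 + x\<^sup>2" for x :: real using zero_le_power2[of "x - 1/2"] by (simp add: power2_eq_square algebra_simps)
    then show "AE \<omega> in N. norm (norm (A \<omega>)) \<le> norm (1 + (norm (A \<omega>))\<^sup>2)" by simp
  qed measurable
qed

lemma L2_bound:
  assumes "prob_space N" "L2 N A" "B \<in> borel_measurable N" "\<And>\<omega>. norm (B \<omega>) \<le> c * (1 + norm (A \<omega>))"
  shows "L2 N B"
  unfolding L2_def
proof (intro conjI)
  interpret prob_space N by fact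
  note [measurable] = L2_measurable[OF assms(2)] assms(3)
  show "integrable N (\<lambda>\<omega>. (norm (B \<omega>))\<^sup>2)"
  proof (rule Bochner_Integration.integrable_bound)
    show "integrable N (\<lambda>\<omega>. c\<^sup>2 * (1 + 2 * norm (A \<omega>) + (norm (A \<omega>))\<^sup>2))"
      using L2_integrable_square[OF assms(2)] L2_integrable_norm[OF assms(1,2)] by simp
    have "(norm (B \<omega>))\<^sup>2 \<le> c\<^sup>2 * (1 + 2 * norm (A \<omega>) + (norm (A \<omega>))\<^sup>2)" for \<omega>
    proof -
      have "(norm (B \<omega>))\<^sup>2 \<le> (c * (1 + norm (A \<omega>)))\<^sup>2" by (intro power_mono assms(4)) simp
      then show ?thesis by (simp add: power2_eq_square algebra_simps)
    qed
    then show "AE \<omega> in N. norm ((norm (B \<omega>))\<^sup>2) \<le> norm (c\<^sup>2 * (1 + 2 * norm (A \<omega>) + (norm (A \<omega>))\<^sup>2))"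
      by (auto simp del: power_mult_distrib)
  qed measurable
qed (rule assms)

lemma L2_mult_integrable:
  fixes f g :: "_ \<Rightarrow> real"
  assumes [measurable]: "f \<in> borel_measurable N" "g \<in> borel_measurable N"
    and "integrable N (\<lambda>\<omega>. (f \<omega>)\<^sup>2)" "integrable N (\<lambda>\<omega>. (g \<omega>)\<^sup>2)"
  shows "integrable N (\<lambda>\<omega>. f \<omega> * g \<omega>)"
proof (rule Bochner_Integration.integrable_bound)
  show "integrable N (\<lambda>\<omega>. (f \<omega>)\<^sup>2 + (g \<omega>)\<^sup>2)" using assms by simp
  have "\<bar>a * b\<bar> \<le> a\<^sup>2 + b\<^sup>2" for a b :: real
  proof -
    have "2 * (\<bar>a\<bar> * \<bar>b\<bar>) \<le> a\<^sup>2 + b\<^sup>2" using sum_squares_bound[of "\<bar>a\<bar>" "\<bar>b\<bar>"] by simp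
    moreover have "0 \<le> \<bar>a\<bar> * \<bar>b\<bar>" by simp
    ultimately show ?thesis unfolding abs_mult by linarith
  qed
  then show "AE \<omega> in N. norm (f \<omega> * g \<omega>) \<le> norm ((f \<omega>)\<^sup>2 + (g \<omega>)\<^sup>2)" by simp
qed measurable

lemma L2_component:
  assumes "L2 N A"
  shows "(\<lambda>\<omega>. A \<omega> $ i) \<in> borel_measurable N" "integrable N (\<lambda>\<omega>. (A \<omega> $ i)\<^sup>2)"
proof -
  have m: "A \<in> borel_measurable N" using assms by (rule L2_measurable)
  have "(\<lambda>\<omega>. A \<omega> \<bullet> axis i 1) \<in> borel_measurable N" using m by measurable
  then show [measurable]: "(\<lambda>\<omega>. A \<omega> $ i) \<in> borel_measurable N" by (simp add: inner_axis)
  show "integrable N (\<lambda>\<omega>. (A \<omega> $ i)\<^sup>2)"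
  proof (rule Bochner_Integration.integrable_bound[OF L2_integrable_square[OF assms]])
    show "AE \<omega> in N. norm ((A \<omega> $ i)\<^sup>2) \<le> norm ((norm (A \<omega>))\<^sup>2)"
      using component_le_norm_cart[of _ i] by (auto simp: abs_le_square_iff[symmetric])
  qed measurable
qed

lemma L2_diff:
  fixes A B :: "'w \<Rightarrow> real^'n"
  assumes "L2 N A" "L2 N B"
  shows "L2 N (\<lambda>\<omega>. A \<omega> - B \<omega>)"
  unfolding L2_def
proof (intro conjI)
  note [measurable] = L2_measurable[OF assms(1)] L2_measurable[OF assms(2)]
  show "(\<lambda>\<omega>. A \<omega> - B \<omega>) \<in> borel_measurable N" by measurable
  show "integrable N (\<lambda>\<omega>. (norm (A \<omega> - B \<omega>))\<^sup>2)"
  proof (rule Bochner_Integration.integrable_bound)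
    show "integrable N (\<lambda>\<omega>. 2 * (norm (A \<omega>))\<^sup>2 + 2 * (norm (B \<omega>))\<^sup>2)"
      using assms by (simp add: L2_def)
    have "(norm (a - b))\<^sup>2 \<le> 2 * (norm a)\<^sup>2 + 2 * (norm b)\<^sup>2" for a b :: "real^'n"
    proof -
      have "(norm (a - b))\<^sup>2 \<le> (norm a + norm b)\<^sup>2" by (intro power_mono norm_triangle_ineq4) simp
      then show ?thesis using sum_squares_bound[of "norm a" "norm b"] by (simp add: power2_sum)
    qed
    then show "AE \<omega> in N. norm ((norm (A \<omega> - B \<omega>))\<^sup>2) \<le> norm (2 * (norm (A \<omega>))\<^sup>2 + 2 * (norm (B \<omega>))\<^sup>2)"
      by simp
  qed measurable
qed

lemma L2_Sform_integrable:
  assumes "L2 N A" "L2 N B"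
  shows "integrable N (\<lambda>\<omega>. Sform S (A \<omega>) (B \<omega>))"
proof -
  note [measurable] = L2_measurable[OF assms(1)] L2_measurable[OF assms(2)]
  obtain K where K: "K > 0" "\<And>a b. norm (Sform S a b) \<le> norm a * norm b * K"
    using Sform.pos_bounded by blast
  have "integrable N (\<lambda>\<omega>. norm (A \<omega>) * norm (B \<omega>))"
    by (rule L2_mult_integrable) (use assms in \<open>auto simp: L2_def\<close>)
  then have "integrable N (\<lambda>\<omega>. norm (A \<omega>) * norm (B \<omega>) * K)" by simp
  then show ?thesis
    by (rule Bochner_Integration.integrable_bound) (use K in \<open>auto intro: order_trans[OF K(2)]\<close>)
qed

text \<open>Stated on any measure so that random variables on \<open>M\<close> and the two
  coordinates under a plan are instances of one notion.\<close>

definition martingale_pair :: "'w measure \<Rightarrow> ('w \<Rightarrow> real^'n) \<Rightarrow> ('w \<Rightarrow> real^'n) \<Rightarrow> bool" where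
  "martingale_pair N U V \<longleftrightarrow> L2 N U \<and> L2 N V \<and>
     (\<forall>i. AE \<omega> in N. real_cond_exp N (vimage_algebra (space N) U borel) (\<lambda>\<omega>. V \<omega> $ i) \<omega> = U \<omega> $ i)"

lemma subalgebra_vimage:
  assumes "U \<in> borel_measurable N" shows "subalgebra N (vimage_algebra (space N) U borel)"
  unfolding subalgebra_def using assms
  by (auto simp: sets_vimage_algebra2 intro: measurable_sets)

lemma martingale_pair_test:
  assumes "prob_space N" and mart: "martingale_pair N U V" and w [measurable]: "w \<in> borel_measurable borel"
    and L2w: "L2 N (\<lambda>\<omega>. w (U \<omega>))"
  shows "(\<integral>\<omega>. w (U \<omega>) \<bullet> V \<omega> \<partial>N) = (\<integral>\<omega>. w (U \<omega>) \<bullet> U \<omega> \<partial>N)"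
proof -
  interpret prob_space N by fact
  have U: "L2 N U" and V: "L2 N V" using mart by (auto simp: martingale_pair_def)
  let ?F = "vimage_algebra (space N) U borel"
  interpret finite_measure_subalgebra N ?F
    by unfold_locales (rule subalgebra_vimage[OF L2_measurable[OF U]])
  have int: "integrable N (\<lambda>\<omega>. w (U \<omega>) $ i * A \<omega> $ i)" if "L2 N A" for A i
    by (intro L2_mult_integrable L2_component that L2w)
  have "(\<integral>\<omega>. w (U \<omega>) $ i * V \<omega> $ i \<partial>N) = (\<integral>\<omega>. w (U \<omega>) $ i * U \<omega> $ i \<partial>N)" for i
  proof -
    have U': "U \<in> borel_measurable ?F" by (rule measurable_vimage_algebra1) simp
    have "(\<lambda>x. w x \<bullet> axis i 1) \<in> borel_measurable borel" by measurable
    then have "(\<lambda>x. w x $ i) \<in> borel_measurable borel" by (simp add: inner_axis)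
    then have m: "(\<lambda>\<omega>. w (U \<omega>) $ i) \<in> borel_measurable ?F" by (rule measurable_compose[OF U'])
    have "(\<integral>\<omega>. w (U \<omega>) $ i * V \<omega> $ i \<partial>N) = (\<integral>\<omega>. w (U \<omega>) $ i * real_cond_exp N ?F (\<lambda>\<omega>. V \<omega> $ i) \<omega> \<partial>N)"
      by (rule real_cond_exp_intg(2)[OF int[OF V] m L2_component(1)[OF V], symmetric])
    also have "\<dots> = (\<integral>\<omega>. w (U \<omega>) $ i * U \<omega> $ i \<partial>N)"
    proof (rule integral_cong_AE)
      show "AE \<omega> in N. w (U \<omega>) $ i * real_cond_exp N ?F (\<lambda>\<omega>. V \<omega> $ i) \<omega> = w (U \<omega>) $ i * U \<omega> $ i"
        using mart unfolding martingale_pair_def by (auto elim: AE_mp)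
      show "(\<lambda>\<omega>. w (U \<omega>) $ i * real_cond_exp N ?F (\<lambda>\<omega>. V \<omega> $ i) \<omega>) \<in> borel_measurable N"
        using L2_component(1)[OF L2w, of i] by measurable
      show "(\<lambda>\<omega>. w (U \<omega>) $ i * U \<omega> $ i) \<in> borel_measurable N"
        using int[OF U] by (rule borel_measurable_integrable)
    qed
    finally show ?thesis .
  qed
  then show ?thesis
    by (simp add: inner_vec_def Bochner_Integration.integral_sum int U V)
qed

lemma martingale_pairI:
  fixes U V :: "'w \<Rightarrow> real^'n"
  assumes "prob_space N" and U: "L2 N U" and V: "L2 N V"
    and zero: "\<And>i B. B \<in> sets borel \<Longrightarrow> (\<integral>\<omega>. indicator B (U \<omega>) * (V \<omega> $ i - U \<omega> $ i) \<partial>N) = 0"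
  shows "martingale_pair N U V"
  unfolding martingale_pair_def
proof (intro conjI allI U V)
  fix i :: 'n
  interpret prob_space N by fact
  let ?F = "vimage_algebra (space N) U borel"
  note [measurable] = L2_measurable[OF U]
  interpret finite_measure_subalgebra N ?F
    by unfold_locales (rule subalgebra_vimage[OF L2_measurable[OF U]])
  have int: "integrable N (\<lambda>\<omega>. A \<omega> $ i)" if "L2 N A" for A
    using L2_mult_integrable[OF _ L2_component(1)[OF that], of "\<lambda>_. 1"] L2_component(2)[OF that] by simp
  show "AE \<omega> in N. real_cond_exp N ?F (\<lambda>\<omega>. V \<omega> $ i) \<omega> = U \<omega> $ i"
  proof (rule real_cond_exp_charact)
    fix A assume "A \<in> sets ?F"
    then obtain B where B: "B \<in> sets borel" "A = U -` B \<inter> space N"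
      by (auto simp: sets_vimage_algebra2)
    have intB: "integrable N (\<lambda>\<omega>. indicator B (U \<omega>) * Z \<omega> $ i)" if "L2 N Z" for Z
    proof (rule Bochner_Integration.integrable_bound[OF int[OF that]])
      note [measurable] = B(1) L2_component(1)[OF that]
      show "(\<lambda>\<omega>. indicator B (U \<omega>) * Z \<omega> $ i) \<in> borel_measurable N" by measurable
    qed (auto simp: indicator_def)
    have eq: "(\<integral>x\<in>A. Z x $ i \<partial>N) = (\<integral>\<omega>. indicator B (U \<omega>) * Z \<omega> $ i \<partial>N)" for Z :: "'w \<Rightarrow> real^'n"
      unfolding set_lebesgue_integral_def
      by (rule Bochner_Integration.integral_cong) (auto simp: B indicator_def)
    show "(\<integral>x\<in>A. V x $ i \<partial>N) = (\<integral>x\<in>A. U x $ i \<partial>N)"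
      using zero[OF B(1), of i] unfolding eq by (simp add: right_diff_distrib intB U V)
  next
    have "(\<lambda>x::real^'n. x \<bullet> axis i 1) \<in> borel_measurable borel" by measurable
    then have "(\<lambda>x::real^'n. x $ i) \<in> borel_measurable borel" by (simp add: inner_axis)
    then show "(\<lambda>\<omega>. U \<omega> $ i) \<in> borel_measurable ?F"
      by (rule measurable_compose[OF measurable_vimage_algebra1, rotated]) simp
  qed (intro int U V)+
qed

text \<open>A Dynkin system argument: closed sets form an intersection-stable generator. As
  \<open>h\<close> is signed, disjoint unions are handled by dominated convergence with majorant
  \<open>\<bar>h \<omega>\<bar>\<close>, and complements by the closed set
  \<open>UNIV\<close>.\<close>

lemma integral_indicator_zero_borel:
  fixes U :: "'w \<Rightarrow> 'a::euclidean_space" and h :: "'w \<Rightarrow> real"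
  assumes U [measurable]: "U \<in> borel_measurable N" and h: "integrable N h"
    and zero: "\<And>C. closed C \<Longrightarrow> (\<integral>\<omega>. indicator C (U \<omega>) * h \<omega> \<partial>N) = 0"
    and B: "B \<in> sets borel"
  shows "(\<integral>\<omega>. indicator B (U \<omega>) * h \<omega> \<partial>N) = 0"
proof -
  have [measurable]: "h \<in> borel_measurable N" using h by (rule borel_measurable_integrable)
  have int: "integrable N (\<lambda>\<omega>. indicator A (U \<omega>) * h \<omega>)" if [measurable]: "A \<in> sets borel" for A
    by (rule Bochner_Integration.integrable_bound[OF h]) (auto simp: indicator_def)
  have "Int_stable (Collect closed :: 'a set set)" by (auto simp: Int_stable_def)
  moreover have "Collect closed \<subseteq> Pow (UNIV :: 'a set)" by simp
  moreover have "B \<in> sigma_sets UNIV (Collect closed)"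
    using B unfolding borel_eq_closed by simp
  ultimately show ?thesis
  proof (induction rule: sigma_sets_induct_disjoint)
    case (basic A) then show ?case using zero by simp
  next
    case empty then show ?case by simp
  next
    case (compl A)
    then have [measurable]: "A \<in> sets borel" by (simp add: borel_eq_closed)
    have "(\<integral>\<omega>. indicator (UNIV - A) (U \<omega>) * h \<omega> \<partial>N)
       = (\<integral>\<omega>. indicator UNIV (U \<omega>) * h \<omega> - indicator A (U \<omega>) * h \<omega> \<partial>N)"
      by (rule Bochner_Integration.integral_cong) (auto simp: indicator_def)
    also have "\<dots> = 0" using zero[of UNIV] compl(2) int[of UNIV] int[of A] by (subst Bochner_Integration.integral_diff) auto
    finally show ?case .
  next
    case (union A)
    then have [measurable]: "A i \<in> sets borel" for i by (auto simp: borel_eq_closed)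
    have "(\<lambda>k. \<integral>\<omega>. (\<Sum>i<k. indicator (A i) (U \<omega>)) * h \<omega> \<partial>N) \<longlonglongrightarrow> (\<integral>\<omega>. indicator (\<Union>i. A i) (U \<omega>) * h \<omega> \<partial>N)"
    proof (rule integral_dominated_convergence)
      show "integrable N (\<lambda>\<omega>. \<bar>h \<omega>\<bar>)" using h by simp
      have sum_eq: "(\<Sum>i<k. indicator (A i) x) = (indicator (\<Union>i<k. A i) x :: real)" for k x
        using union(1) by (subst indicator_UN_disjoint) (auto simp: disjoint_family_on_def)
      show "AE \<omega> in N. norm ((\<Sum>i<k. indicator (A i) (U \<omega>)) * h \<omega>) \<le> \<bar>h \<omega>\<bar>" for k
        unfolding sum_eq by (auto simp: indicator_def)
      have "(\<lambda>k. (\<Sum>i<k. indicator (A i) x)) \<longlonglongrightarrow> (indicator (\<Union>i. A i) x :: real)" for x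
        unfolding sum_eq by (rule LIMSEQ_indicator_UN)
      then show "AE \<omega> in N. (\<lambda>k. (\<Sum>i<k. indicator (A i) (U \<omega>)) * h \<omega>) \<longlonglongrightarrow> indicator (\<Union>i. A i) (U \<omega>) * h \<omega>"
        by (auto intro!: tendsto_mult_right)
      have "(\<Union>i. A i) \<in> sets borel" by (rule sets.countable_UN) auto
      then show "(\<lambda>\<omega>. indicator (\<Union>i. A i) (U \<omega>) * h \<omega>) \<in> borel_measurable N"
        by (intro borel_measurable_integrable int)
      show "(\<lambda>\<omega>. (\<Sum>i<k. indicator (A i) (U \<omega>)) * h \<omega>) \<in> borel_measurable N" for k
        by measurable
    qed
    moreover have "(\<integral>\<omega>. (\<Sum>i<k. indicator (A i) (U \<omega>)) * h \<omega> \<partial>N) = 0" for k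
      unfolding sum_distrib_right by (subst Bochner_Integration.integral_sum) (use int union(3) in auto)
    ultimately show ?case by (simp add: LIMSEQ_const_iff)
  qed
qed

text \<open>\<open>e2ennreal\<close> and \<open>ennreal\<close> send negative values to 0, so the
  two terms of \<open>dual_obj\<close> are the integrals of the positive and negative parts of
  \<open>g\<close>.\<close>

lemma dual_obj_eq_integral:
  assumes [measurable]: "Y \<in> borel_measurable M" and g: "integrable M g"
    and eq: "AE \<omega> in M. psi S H (Y \<omega>) = ereal (g \<omega>)"
  shows "dual_obj S (distr M borel Y) H = ereal (\<integral>\<omega>. g \<omega> \<partial>M)"
proof -
  have fin: "(\<integral>\<^sup>+\<omega>. ennreal (g \<omega>) \<partial>M) < \<infinity>" "(\<integral>\<^sup>+\<omega>. ennreal (- g \<omega>) \<partial>M) < \<infinity>"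
    using g by (auto simp: real_integrable_def less_top)
  have to_ereal: "enn2ereal a = ereal (enn2real a)" if "a < \<infinity>" for a
    using that by (cases a) auto
  have "(\<integral>\<^sup>+ y. e2ennreal (psi S H y) \<partial>distr M borel Y) = (\<integral>\<^sup>+\<omega>. ennreal (g \<omega>) \<partial>M)"
    by (subst nn_integral_distr) (auto intro!: nn_integral_cong_AE intro: AE_mp[OF eq])
  moreover have "(\<integral>\<^sup>+ y. e2ennreal (- psi S H y) \<partial>distr M borel Y) = (\<integral>\<^sup>+\<omega>. ennreal (- g \<omega>) \<partial>M)"
    by (subst nn_integral_distr) (auto intro!: nn_integral_cong_AE intro: AE_mp[OF eq])
  ultimately show ?thesis
    unfolding dual_obj_def real_lebesgue_integral_def[OF g] using to_ereal[OF fin(1)] to_ereal[OF fin(2)] by simp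
qed

section \<open>The dual functional and weak duality\<close>

text \<open>An infinite value becomes 0 here, so each use is paired with an almost sure statement
  that \<psi> is real.\<close>

abbreviation rpsi :: "real^'n^'n \<Rightarrow> (real^'n) set \<Rightarrow> real^'n \<Rightarrow> real" where
  "rpsi S G y \<equiv> real_of_ereal (psi S G y)"

context sign_split
begin

lemma covers_psi_ge:
  assumes "covers S A" shows "ereal (Sform S y y / 2) \<le> psi S A y"
proof -
  obtain x where x: "x \<in> A" "Sform S (y - x) (y - x) \<le> 0" using assms unfolding covers_def by blast
  then have "Sform S y y / 2 \<le> tangent S x y" by (simp add: tangent_eq)
  then show ?thesis unfolding psi_def using x(1) by (intro SUP_upper2) (auto simp: tangent_def)
qed

lemma rpsi_integrable_of_bound:
  assumes Y: "L2 M Y" and A: "covers S A" and f: "integrable M f"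
    and le: "AE \<omega> in M. psi S A (Y \<omega>) \<le> ereal (f \<omega>)"
  shows "integrable M (\<lambda>\<omega>. rpsi S A (Y \<omega>))" "AE \<omega> in M. psi S A (Y \<omega>) = ereal (rpsi S A (Y \<omega>))"
proof -
  note [measurable] = L2_measurable[OF Y]
  have real: "psi S A y = ereal (rpsi S A y) \<and> Sform S y y / 2 \<le> rpsi S A y \<and> rpsi S A y \<le> r"
    if "psi S A y \<le> ereal r" for y r
    using that covers_psi_ge[OF A, of y] by (cases "psi S A y") auto
  then show "AE \<omega> in M. psi S A (Y \<omega>) = ereal (rpsi S A (Y \<omega>))" using le by (auto elim: AE_mp)
  show "integrable M (\<lambda>\<omega>. rpsi S A (Y \<omega>))"
  proof (rule Bochner_Integration.integrable_bound)
    show "integrable M (\<lambda>\<omega>. \<bar>f \<omega>\<bar> + \<bar>Sform S (Y \<omega>) (Y \<omega>) / 2\<bar>)"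
      using f L2_Sform_integrable[OF Y Y, of S] by (intro Bochner_Integration.integrable_add integrable_abs) auto
    have "\<bar>rpsi S A y\<bar> \<le> \<bar>\<bar>r\<bar> + \<bar>Sform S y y / 2\<bar>\<bar>" if "psi S A y \<le> ereal r" for y r
      using real[OF that] by linarith
    then show "AE \<omega> in M. norm (rpsi S A (Y \<omega>)) \<le> norm (\<bar>f \<omega>\<bar> + \<bar>Sform S (Y \<omega>) (Y \<omega>) / 2\<bar>)"
      using le unfolding real_norm_def by (auto elim!: AE_mp)
  qed measurable
qed

text \<open>The majorant property bounds the negative part of \<psi> by that of the integrable
  \<open>c(Y)\<close>. No difference of infinities can occur, and a dual value below infinity
  controls the positive part.\<close>

lemma rpsi_integrable_of_dual_obj:
  assumes Y: "L2 M Y" and A: "covers S A" and fin: "dual_obj S (distr M borel Y) A < \<infinity>"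
  shows "integrable M (\<lambda>\<omega>. rpsi S A (Y \<omega>))" "AE \<omega> in M. psi S A (Y \<omega>) = ereal (rpsi S A (Y \<omega>))"
proof -
  note [measurable] = L2_measurable[OF Y]
  let ?p = "\<integral>\<^sup>+\<omega>. e2ennreal (psi S A (Y \<omega>)) \<partial>M" and ?n = "\<integral>\<^sup>+\<omega>. e2ennreal (- psi S A (Y \<omega>)) \<partial>M"
  have dual: "dual_obj S (distr M borel Y) A = enn2ereal ?p - enn2ereal ?n"
    unfolding dual_obj_def by (simp add: nn_integral_distr)
  have c: "integrable M (\<lambda>\<omega>. Sform S (Y \<omega>) (Y \<omega>) / 2)" using L2_Sform_integrable[OF Y Y] by simp
  have "?n \<le> (\<integral>\<^sup>+\<omega>. ennreal (- (Sform S (Y \<omega>) (Y \<omega>) / 2)) \<partial>M)"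
  proof (rule nn_integral_mono)
    fix \<omega>
    have "- psi S A (Y \<omega>) \<le> ereal (- (Sform S (Y \<omega>) (Y \<omega>) / 2))"
      using covers_psi_ge[OF A, of "Y \<omega>"] by (cases "psi S A (Y \<omega>)") auto
    then have "e2ennreal (- psi S A (Y \<omega>)) \<le> e2ennreal (ereal (- (Sform S (Y \<omega>) (Y \<omega>) / 2)))"
      by (rule e2ennreal_mono)
    then show "e2ennreal (- psi S A (Y \<omega>)) \<le> ennreal (- (Sform S (Y \<omega>) (Y \<omega>) / 2))" by simp
  qed
  also have "\<dots> < \<infinity>" using c unfolding real_integrable_def by (simp add: less_top)
  finally have n: "?n < \<infinity>" .
  have p: "?p \<noteq> \<infinity>"
  proof
    assume "?p = \<infinity>"
    moreover obtain r where "?n = ennreal r" "r \<ge> 0" using n by (cases ?n) auto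
    ultimately show False using fin unfolding dual by simp
  qed
  then have "AE \<omega> in M. e2ennreal (psi S A (Y \<omega>)) \<noteq> \<infinity>" by (intro nn_integral_PInf_AE) auto
  then show eq: "AE \<omega> in M. psi S A (Y \<omega>) = ereal (rpsi S A (Y \<omega>))"
  proof (rule AE_mp, intro AE_I2 impI)
    fix \<omega> assume "e2ennreal (psi S A (Y \<omega>)) \<noteq> \<infinity>"
    then show "psi S A (Y \<omega>) = ereal (rpsi S A (Y \<omega>))"
      using covers_psi_ge[OF A, of "Y \<omega>"] by (cases "psi S A (Y \<omega>)") auto
  qed
  have "(\<integral>\<^sup>+\<omega>. ennreal (rpsi S A (Y \<omega>)) \<partial>M) = ?p"
    using eq by (intro nn_integral_cong_AE) (auto elim!: AE_mp simp flip: e2ennreal_ereal)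
  moreover have "(\<integral>\<^sup>+\<omega>. ennreal (- rpsi S A (Y \<omega>)) \<partial>M) = ?n"
    using eq by (intro nn_integral_cong_AE) (auto elim!: AE_mp simp flip: e2ennreal_ereal uminus_ereal.simps)
  ultimately show "integrable M (\<lambda>\<omega>. rpsi S A (Y \<omega>))"
    unfolding real_integrable_def using p n by simp
qed

text \<open>The positive space is a competitor whose \<psi> grows at most quadratically; it shows
  that the optimal dual value is below infinity.\<close>

lemma range_P_maximal: "range P \<in> MS S"
proof (rule monotone_full_maximal)
  show "S_monotone S (range P)"
    unfolding S_monotone_def using Sform_P_nonneg by (auto simp flip: P_diff)
qed (use P_idem in blast)

lemma psi_range_P_le: "psi S (range P) y \<le> ereal (Sform S (P y) (P y) / 2)"
  unfolding psi_le_iff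
proof clarify
  fix a
  have "0 \<le> Sform S (P (y - a)) (P (y - a))" by (rule Sform_P_nonneg)
  then show "tangent S (P a) y \<le> Sform S (P y) (P y) / 2"
    unfolding tangent_def Sform_P_left[of a y]
    by (simp add: P_diff Sform.diff_left Sform.diff_right Sform_sym[of "P y" "P a"])
qed

lemma L2_P:
  assumes "L2 M Y" shows "L2 M (\<lambda>\<omega>. P (Y \<omega>))"
proof -
  obtain B where B: "B > 0" "\<And>x. norm (P x) \<le> norm x * B"
    using bounded_linear.pos_bounded[OF bounded_linear_P] by blast
  have [measurable]: "(\<lambda>\<omega>. P (Y \<omega>)) \<in> borel_measurable M"
    by (rule measurable_compose[OF L2_measurable[OF assms]])
       (intro borel_measurable_continuous_onI linear_continuous_on bounded_linear_P)
  show ?thesis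
    unfolding L2_def
  proof (intro conjI)
    show "integrable M (\<lambda>\<omega>. (norm (P (Y \<omega>)))\<^sup>2)"
    proof (rule Bochner_Integration.integrable_bound)
      show "integrable M (\<lambda>\<omega>. B\<^sup>2 * (norm (Y \<omega>))\<^sup>2)" using L2_integrable_square[OF assms] by simp
      have "(norm (P y))\<^sup>2 \<le> B\<^sup>2 * (norm y)\<^sup>2" for y
        using power_mono[OF B(2)[of y], of 2] by (simp add: power_mult_distrib mult.commute)
      then show "AE \<omega> in M. norm ((norm (P (Y \<omega>)))\<^sup>2) \<le> norm (B\<^sup>2 * (norm (Y \<omega>))\<^sup>2)" by simp
    qed measurable
  qed measurable
qed

lemma optimal_dual_rpsi:
  assumes Y: "L2 M Y" and G: "optimal_dual_set S (distr M borel Y) G"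
  shows "integrable M (\<lambda>\<omega>. rpsi S G (Y \<omega>))" "AE \<omega> in M. psi S G (Y \<omega>) = ereal (rpsi S G (Y \<omega>))"
proof -
  have f: "integrable M (\<lambda>\<omega>. Sform S (P (Y \<omega>)) (P (Y \<omega>)) / 2)"
    using L2_Sform_integrable[OF L2_P[OF Y] L2_P[OF Y]] by simp
  note H = rpsi_integrable_of_bound[OF Y maximal_covers[OF range_P_maximal] f]
  have "dual_obj S (distr M borel Y) (range P) = ereal (\<integral>\<omega>. rpsi S (range P) (Y \<omega>) \<partial>M)"
    using psi_range_P_le by (intro dual_obj_eq_integral L2_measurable[OF Y] H) auto
  then have "dual_obj S (distr M borel Y) G < \<infinity>"
    using G range_P_maximal unfolding optimal_dual_set_def by (metis ereal_infty_less(1) ereal_infty_less_eq(1) ereal.distinct(1) not_less order_le_less_trans less_ereal.simps(4))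
  moreover have "covers S G" using G by (intro maximal_covers) (simp add: optimal_dual_set_def)
  ultimately show "integrable M (\<lambda>\<omega>. rpsi S G (Y \<omega>))" "AE \<omega> in M. psi S G (Y \<omega>) = ereal (rpsi S G (Y \<omega>))"
    using rpsi_integrable_of_dual_obj[OF Y] by blast+
qed

text \<open>Extends optimality of \<open>G\<close> from maximal sets to all covering sets, by
  passing to a maximal set with smaller or equal \<psi>. This is the form needed for the moved
  copies of \<open>G\<close>.\<close>

lemma optimal_dual_le:
  assumes Y: "L2 M Y" and G: "optimal_dual_set S (distr M borel Y) G" and A: "covers S A"
    and f: "integrable M f" and le: "AE \<omega> in M. \<forall>x\<in>A. tangent S x (Y \<omega>) \<le> f \<omega>"
  shows "(\<integral>\<omega>. rpsi S G (Y \<omega>) \<partial>M) \<le> (\<integral>\<omega>. f \<omega> \<partial>M)"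
proof -
  obtain H where H: "H \<in> MS S"
    and dom: "\<And>y r. (\<forall>x\<in>A. tangent S x y \<le> r) \<Longrightarrow> (\<forall>x\<in>H. tangent S x y \<le> r)"
    using covers_dominates_maximal[OF A] by blast
  have le': "AE \<omega> in M. psi S H (Y \<omega>) \<le> ereal (f \<omega>)"
    unfolding psi_le_iff using le dom by (auto elim!: AE_mp)
  note rH = rpsi_integrable_of_bound[OF Y maximal_covers[OF H] f le']
  have "dual_obj S (distr M borel Y) G = ereal (\<integral>\<omega>. rpsi S G (Y \<omega>) \<partial>M)"
    by (intro dual_obj_eq_integral L2_measurable[OF Y] optimal_dual_rpsi[OF Y G])
  moreover have "dual_obj S (distr M borel Y) H = ereal (\<integral>\<omega>. rpsi S H (Y \<omega>) \<partial>M)"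
    by (intro dual_obj_eq_integral L2_measurable[OF Y] rH)
  ultimately have "(\<integral>\<omega>. rpsi S G (Y \<omega>) \<partial>M) \<le> (\<integral>\<omega>. rpsi S H (Y \<omega>) \<partial>M)"
    using G H unfolding optimal_dual_set_def by (metis ereal_less_eq(3))
  also have "\<dots> \<le> (\<integral>\<omega>. f \<omega> \<partial>M)"
  proof (rule integral_mono_AE[OF rH(1) f])
    show "AE \<omega> in M. rpsi S H (Y \<omega>) \<le> f \<omega>"
      using le' rH(2) by eventually_elim (metis ereal_less_eq(3))
  qed
  finally show ?thesis .
qed

section \<open>Weak duality and its equality case\<close>

lemma martingale_pair_Sform:
  assumes "prob_space N" "martingale_pair N U V" and w: "w \<in> borel_measurable borel" and L2w: "L2 N (\<lambda>\<omega>. w (U \<omega>))"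
  shows "(\<integral>\<omega>. Sform S (w (U \<omega>)) (V \<omega>) \<partial>N) = (\<integral>\<omega>. Sform S (w (U \<omega>)) (U \<omega>) \<partial>N)"
proof -
  have eq: "Sform S a b = (S *v a) \<bullet> b" for a b
    using Sform_sym[of a b] by (simp add: Sform_def inner_commute)
  obtain B where B: "B > 0" "\<And>x. norm (S *v x) \<le> norm x * B"
    using bounded_linear.pos_bounded[OF matrix_vector_mul_bounded_linear[of S]] by blast
  have m: "(*v) S \<in> borel_measurable borel"
    by (intro borel_measurable_continuous_onI linear_continuous_on matrix_vector_mul_bounded_linear)
  have "L2 N (\<lambda>\<omega>. S *v w (U \<omega>))"
  proof (rule L2_bound[OF assms(1) L2w])
    show "(\<lambda>\<omega>. S *v w (U \<omega>)) \<in> borel_measurable N"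
      by (rule measurable_compose[OF L2_measurable[OF L2w] m])
    show "norm (S *v w (U \<omega>)) \<le> B * (1 + norm (w (U \<omega>)))" for \<omega>
      using B(2)[of "w (U \<omega>)"] B(1) by (simp add: algebra_simps)
  qed
  then show ?thesis
    unfolding eq by (intro martingale_pair_test[OF assms(1,2)] measurable_compose[OF w m])
qed

text \<open>\<open>\<psi>\<^sub>G(V)\<close> is bounded below by the tangent at the point of \<open>G\<close> lying over \<open>U\<close>.\<close>

lemma weak_duality:
  assumes N: "prob_space N" and mart: "martingale_pair N U V" and G: "G \<in> MS S"
    and int: "integrable N (\<lambda>\<omega>. rpsi S G (V \<omega>))" and fin: "AE \<omega> in N. psi S G (V \<omega>) = ereal (rpsi S G (V \<omega>))"
  shows "(\<integral>\<omega>. Sform S (U \<omega>) (V \<omega>) \<partial>N) / 2 \<le> (\<integral>\<omega>. rpsi S G (V \<omega>) \<partial>N)"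
    and "(\<integral>\<omega>. Sform S (U \<omega>) (V \<omega>) \<partial>N) / 2 = (\<integral>\<omega>. rpsi S G (V \<omega>) \<partial>N) \<Longrightarrow> AE \<omega> in N. U \<omega> \<in> PG S G (V \<omega>)"
proof -
  interpret prob_space N by fact
  have U: "L2 N U" and V: "L2 N V" using mart by (auto simp: martingale_pair_def)
  note [measurable] = L2_measurable[OF U] L2_measurable[OF V]
  have sel_m [measurable]: "sel G \<in> borel_measurable borel"
    by (intro borel_measurable_continuous_onI continuous_sel G)
  obtain L where L: "\<And>a. norm (sel G a) \<le> L * (1 + norm a)" using norm_sel_le[OF G] by blast
  define z where "z = (\<lambda>\<omega>. sel G (U \<omega>))"
  have z: "L2 N z" unfolding z_def
    by (rule L2_bound[OF N U, of _ L]) (use L in auto)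
  have zG: "z \<omega> \<in> G" and Pz: "P (U \<omega> - z \<omega>) = 0" for \<omega>
    using sel_in[OF G] P_sel[OF G] by (auto simp: z_def P_diff)
  have t_le: "tangent S x (V \<omega>) \<le> rpsi S G (V \<omega>)"
    if "psi S G (V \<omega>) = ereal (rpsi S G (V \<omega>))" "x \<in> G" for x \<omega>
    using psi_le_iff[of S G "V \<omega>" "rpsi S G (V \<omega>)"] that by auto
  have EU: "(\<integral>\<omega>. Sform S (U \<omega>) (V \<omega>) \<partial>N) = (\<integral>\<omega>. Sform S (U \<omega>) (U \<omega>) \<partial>N)"
    using martingale_pair_Sform[OF N mart, of "\<lambda>x. x"] U by simp
  have Ez: "(\<integral>\<omega>. Sform S (z \<omega>) (V \<omega>) \<partial>N) = (\<integral>\<omega>. Sform S (z \<omega>) (U \<omega>) \<partial>N)"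
    unfolding z_def by (rule martingale_pair_Sform[OF N mart]) (use z in \<open>auto simp: z_def\<close>)
  note ints = L2_Sform_integrable[OF U U, of S] L2_Sform_integrable[OF z U, of S] L2_Sform_integrable[OF z z, of S]
    L2_Sform_integrable[OF z V, of S] L2_Sform_integrable[OF U V, of S]
    L2_Sform_integrable[OF L2_diff[OF U z] L2_diff[OF U z], of S]
  \<comment> \<open>The duality defect splits into two nonnegative integrals: \<open>gap\<close>
    measures how far \<open>z\<close> is from maximising, \<open>def\<close> how far
    \<open>U\<close> is from \<open>G\<close>. The martingale property, tested with \<open>U\<close>
    and with \<open>z\<close>, makes the sum exact.\<close>
  define gap where "gap \<omega> = rpsi S G (V \<omega>) - tangent S (z \<omega>) (V \<omega>)" for \<omega>
  define def where "def \<omega> = - Sform S (U \<omega> - z \<omega>) (U \<omega> - z \<omega>) / 2" for \<omega>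
  have gap_int: "integrable N gap" and def_int: "integrable N def"
    unfolding gap_def[abs_def] def_def[abs_def] tangent_def using ints int by auto
  have gap0: "AE \<omega> in N. gap \<omega> \<ge> 0" using fin unfolding gap_def by eventually_elim (use t_le zG in simp)
  have def0: "def \<omega> \<ge> 0" for \<omega> using Sform_ker_P_nonpos[OF Pz, of \<omega>] by (simp add: def_def)
  have id: "(\<integral>\<omega>. rpsi S G (V \<omega>) \<partial>N) = (\<integral>\<omega>. Sform S (U \<omega>) (V \<omega>) \<partial>N) / 2 + (\<integral>\<omega>. gap \<omega> \<partial>N) + (\<integral>\<omega>. def \<omega> \<partial>N)"
  proof -
    have "(\<integral>\<omega>. gap \<omega> \<partial>N) = (\<integral>\<omega>. rpsi S G (V \<omega>) \<partial>N) - ((\<integral>\<omega>. Sform S (z \<omega>) (V \<omega>) \<partial>N) - (\<integral>\<omega>. Sform S (z \<omega>) (z \<omega>) \<partial>N) / 2)"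
      unfolding gap_def tangent_def using ints int by simp
    moreover have "(\<integral>\<omega>. def \<omega> \<partial>N) = - (\<integral>\<omega>. Sform S (U \<omega>) (U \<omega>) - 2 * Sform S (z \<omega>) (U \<omega>) + Sform S (z \<omega>) (z \<omega>) \<partial>N) / 2"
    proof -
      have "def \<omega> = - (Sform S (U \<omega>) (U \<omega>) - 2 * Sform S (z \<omega>) (U \<omega>) + Sform S (z \<omega>) (z \<omega>)) / 2" for \<omega>
        unfolding def_def by (simp add: Sform.diff_left Sform.diff_right Sform_sym[of "U _" "z _"])
      then show ?thesis by (simp only: integral_divide_zero integral_minus)
    qed
    moreover have "(\<integral>\<omega>. Sform S (U \<omega>) (U \<omega>) - 2 * Sform S (z \<omega>) (U \<omega>) + Sform S (z \<omega>) (z \<omega>) \<partial>N)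
      = (\<integral>\<omega>. Sform S (U \<omega>) (U \<omega>) \<partial>N) - 2 * (\<integral>\<omega>. Sform S (z \<omega>) (U \<omega>) \<partial>N) + (\<integral>\<omega>. Sform S (z \<omega>) (z \<omega>) \<partial>N)"
      using ints by simp
    ultimately show ?thesis using EU Ez by simp
  qed
  have nn: "(\<integral>\<omega>. gap \<omega> \<partial>N) \<ge> 0" "(\<integral>\<omega>. def \<omega> \<partial>N) \<ge> 0"
    using gap0 def0 by (auto intro: integral_nonneg_AE)
  then show "(\<integral>\<omega>. Sform S (U \<omega>) (V \<omega>) \<partial>N) / 2 \<le> (\<integral>\<omega>. rpsi S G (V \<omega>) \<partial>N)" using id by simp
  assume "(\<integral>\<omega>. Sform S (U \<omega>) (V \<omega>) \<partial>N) / 2 = (\<integral>\<omega>. rpsi S G (V \<omega>) \<partial>N)"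
  then have "(\<integral>\<omega>. gap \<omega> \<partial>N) = 0" "(\<integral>\<omega>. def \<omega> \<partial>N) = 0" using id nn by linarith+
  then have "AE \<omega> in N. gap \<omega> = 0" "AE \<omega> in N. def \<omega> = 0"
    using integral_nonneg_eq_0_iff_AE[OF gap_int gap0] integral_nonneg_eq_0_iff_AE[OF def_int] def0 by auto
  then show "AE \<omega> in N. U \<omega> \<in> PG S G (V \<omega>)"
    using fin
  proof eventually_elim
    case (elim \<omega>)
    have "U \<omega> - z \<omega> = 0" using elim(2) by (intro Sform_ker_P_eq_0[OF Pz]) (simp add: def_def)
    then have "U \<omega> = z \<omega>" by simp
    then show ?case using elim zG[of \<omega>] t_le[OF elim(3)] by (simp add: PG_iff gap_def)
  qed
qed

end

section \<open>Stationarity of an optimal set\<close>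

context sign_split
begin

text \<open>\<open>Z\<close> is the lower limit of \<open>W\<close> minus the difference quotients
  \<open>h n\<close> of \<psi>. Optimality makes the integrals of \<open>h n\<close> nonnegative,
  and Fatou's lemma bounds the integral of \<open>Z\<close>. In \<open>W\<close> the final
  \<open>D\<close> absorbs the second-order term, since the times are at most 1. A free strict bound
  \<open>L\<close> replaces a maximum over \<open>PG S G (Y \<omega>)\<close>, which may be
  empty.\<close>

lemma fatou_perturbation:
  assumes M: "prob_space M" and Y: "L2 M Y" and G: "optimal_dual_set S (distr M borel Y) G"
    and cont: "continuous_on UNIV \<phi>" and bd: "\<And>x. norm (\<phi> x) \<le> C"
    and supp: "\<And>x. norm x > R \<Longrightarrow> \<phi> x = 0" and e: "e > 0"
    and D: "D > 0"
      "\<And>x y. \<bar>Sform S (\<phi> x) (y - x)\<bar> \<le> D * (1 + norm y)"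
      "\<And>x e. - Sform S (velocity \<phi> e x) (velocity \<phi> e x) / 2 \<le> D"
      "\<And>x y. Sform S (P x) (y - x) \<le> D * (norm y)\<^sup>2"
  defines "W \<equiv> \<lambda>\<omega>. D * (1 + norm (Y \<omega>)) + e * (D * (norm (Y \<omega>))\<^sup>2) + D"
  obtains Z :: "'w \<Rightarrow> ennreal" where "Z \<in> borel_measurable M"
    "(\<integral>\<^sup>+\<omega>. Z \<omega> \<partial>M) \<le> ennreal (\<integral>\<omega>. W \<omega> \<partial>M)"
    "AE \<omega> in M. \<forall>L. (\<forall>x\<in>PG S G (Y \<omega>). Sform S (velocity \<phi> e x) (Y \<omega> - x) < L) \<longrightarrow> ennreal (W \<omega> - L) \<le> Z \<omega>"
proof -
  interpret prob_space M by fact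
  note [measurable] = L2_measurable[OF Y]
  have GM: "G \<in> MS S" using G by (simp add: optimal_dual_set_def)
  note g = optimal_dual_rpsi[OF Y G]
  have W_int: "integrable M W"
    unfolding W_def using L2_integrable_norm[OF M Y] L2_integrable_square[OF Y] by simp
  define t where "t n = 1 / real (Suc n)" for n
  have t: "t n > 0" "t n \<le> 1" for n by (auto simp: t_def field_simps)
  have t_lim: "t \<longlonglongrightarrow> 0" unfolding t_def[abs_def] by (rule LIMSEQ_Suc[OF lim_1_over_n])
  define A where "A n = (\<lambda>x. x + t n *\<^sub>R velocity \<phi> e x) ` G" for n
  have cov: "covers S (A n)" for n
    unfolding A_def velocity_def by (rule covers_perturbed[OF GM cont bd]) (use t[of n] e in auto)
  have up: "tangent S x (Y \<omega>) \<le> rpsi S G (Y \<omega>)"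
    if "psi S G (Y \<omega>) = ereal (rpsi S G (Y \<omega>))" "x \<in> G" for \<omega> x
    using psi_le_iff[of S G "Y \<omega>" "rpsi S G (Y \<omega>)"] that by auto
  have A_le: "psi S (A n) (Y \<omega>) \<le> ereal (rpsi S G (Y \<omega>) + t n * W \<omega>)"
    if *: "psi S G (Y \<omega>) = ereal (rpsi S G (Y \<omega>))" for n \<omega>
    unfolding psi_le_iff A_def
  proof clarify
    fix x assume "x \<in> G"
    let ?v = "velocity \<phi> e x"
    have v: "Sform S ?v (Y \<omega> - x) \<le> D * (1 + norm (Y \<omega>)) + e * (D * (norm (Y \<omega>))\<^sup>2)"
      unfolding velocity_def Sform.add_left Sform.scaleR_left
      using D(2)[of x "Y \<omega>"] D(4)[of x "Y \<omega>"] e by (auto intro!: add_mono)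
    have "(t n)\<^sup>2 * (- Sform S ?v ?v / 2) \<le> (t n)\<^sup>2 * D" using D(3) e by (intro mult_left_mono) auto
    also have "\<dots> \<le> t n * D" using t[of n] D(1) by (simp add: power2_eq_square mult_left_le_one_le)
    finally have "tangent S (x + t n *\<^sub>R ?v) (Y \<omega>) \<le> tangent S x (Y \<omega>) + t n * Sform S ?v (Y \<omega> - x) + t n * D"
      unfolding tangent_perturbed by simp
    also have "\<dots> \<le> rpsi S G (Y \<omega>) + t n * (D * (1 + norm (Y \<omega>)) + e * (D * (norm (Y \<omega>))\<^sup>2)) + t n * D"
      using up[OF * \<open>x \<in> G\<close>] v t(1)[of n] by (intro add_mono mult_left_mono) auto
    finally show "tangent S (x + t n *\<^sub>R ?v) (Y \<omega>) \<le> rpsi S G (Y \<omega>) + t n * W \<omega>"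
      unfolding W_def by (simp add: algebra_simps)
  qed
  define f where "f n \<omega> = rpsi S (A n) (Y \<omega>)" for n \<omega>
  have ub_int: "integrable M (\<lambda>\<omega>. rpsi S G (Y \<omega>) + t n * W \<omega>)" for n using g W_int by simp
  have A_le': "AE \<omega> in M. psi S (A n) (Y \<omega>) \<le> ereal (rpsi S G (Y \<omega>) + t n * W \<omega>)" for n
    using g(2) by eventually_elim (rule A_le)
  note fA = rpsi_integrable_of_bound[OF Y cov ub_int A_le', folded f_def]
  have f_meas [measurable]: "f n \<in> borel_measurable M" for n using fA(1)[of n] by simp
  have g_le: "(\<integral>\<omega>. rpsi S G (Y \<omega>) \<partial>M) \<le> (\<integral>\<omega>. f n \<omega> \<partial>M)" for n
  proof (rule optimal_dual_le[OF Y G cov fA(1)])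
    show "AE \<omega> in M. \<forall>x\<in>A n. tangent S x (Y \<omega>) \<le> f n \<omega>"
      using fA(2)[of n] by eventually_elim (auto simp flip: psi_le_iff)
  qed
  define h where "h n \<omega> = (f n \<omega> - rpsi S G (Y \<omega>)) / t n" for n \<omega>
  have h_int: "integrable M (h n)" for n unfolding h_def[abs_def] using fA(1)[of n] g(1) by simp
  have h_le: "AE \<omega> in M. h n \<omega> \<le> W \<omega>" for n
    using A_le'[of n] fA(2)[of n]
  proof eventually_elim
    case (elim \<omega>)
    then have "f n \<omega> - rpsi S G (Y \<omega>) \<le> W \<omega> * t n" by (simp add: mult.commute)
    then show ?case unfolding h_def using t(1)[of n] by (simp add: pos_divide_le_eq)
  qed
  have h_ge: "(\<integral>\<omega>. h n \<omega> \<partial>M) \<ge> 0" for n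
    unfolding h_def using g_le[of n] fA(1)[of n] g(1) t(1)[of n] by simp
  define Z where "Z \<omega> = liminf (\<lambda>n. ennreal (W \<omega> - h n \<omega>))" for \<omega>
  have [measurable]: "W \<in> borel_measurable M" "h n \<in> borel_measurable M" for n
    using W_int h_int by auto
  show thesis
  proof (rule that)
    show "Z \<in> borel_measurable M" unfolding Z_def[abs_def] by measurable
    have "(\<integral>\<^sup>+\<omega>. Z \<omega> \<partial>M) \<le> liminf (\<lambda>n. \<integral>\<^sup>+\<omega>. ennreal (W \<omega> - h n \<omega>) \<partial>M)"
      unfolding Z_def by (rule nn_integral_liminf) measurable
    also have "\<dots> \<le> liminf (\<lambda>n. ennreal (\<integral>\<omega>. W \<omega> \<partial>M))"
    proof (intro Liminf_mono always_eventually allI)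
      fix n
      have "(\<integral>\<^sup>+\<omega>. ennreal (W \<omega> - h n \<omega>) \<partial>M) = ennreal (\<integral>\<omega>. W \<omega> - h n \<omega> \<partial>M)"
        using h_le[of n] W_int h_int[of n] by (intro nn_integral_eq_integral) auto
      also have "\<dots> \<le> ennreal (\<integral>\<omega>. W \<omega> \<partial>M)"
        using h_ge[of n] W_int h_int[of n] by (intro ennreal_leI) simp
      finally show "(\<integral>\<^sup>+\<omega>. ennreal (W \<omega> - h n \<omega>) \<partial>M) \<le> ennreal (\<integral>\<omega>. W \<omega> \<partial>M)" .
    qed
    also have "\<dots> = ennreal (\<integral>\<omega>. W \<omega> \<partial>M)" by (simp add: Liminf_const)
    finally show "(\<integral>\<^sup>+\<omega>. Z \<omega> \<partial>M) \<le> ennreal (\<integral>\<omega>. W \<omega> \<partial>M)" .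
    have "AE \<omega> in M. \<forall>n. psi S (A n) (Y \<omega>) = ereal (f n \<omega>)" using fA(2) by (simp add: AE_all_countable)
    then show "AE \<omega> in M. \<forall>L. (\<forall>x\<in>PG S G (Y \<omega>). Sform S (velocity \<phi> e x) (Y \<omega> - x) < L) \<longrightarrow> ennreal (W \<omega> - L) \<le> Z \<omega>"
      using g(2)
    proof (eventually_elim, intro allI impI)
      fix \<omega> L
      assume fin: "\<forall>n. psi S (A n) (Y \<omega>) = ereal (f n \<omega>)" "psi S G (Y \<omega>) = ereal (rpsi S G (Y \<omega>))"
        and L: "\<forall>x\<in>PG S G (Y \<omega>). Sform S (velocity \<phi> e x) (Y \<omega> - x) < L"
      have "\<forall>\<^sub>F n in sequentially. \<forall>x\<in>G. tangent S (x + t n *\<^sub>R velocity \<phi> e x) (Y \<omega>) \<le> rpsi S G (Y \<omega>) + t n * L"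
        by (rule perturbed_tangent_eventually_le[OF GM cont bd supp e up[OF fin(2)] t(1) t_lim]) (use L in auto)
      then have "\<forall>\<^sub>F n in sequentially. ennreal (W \<omega> - L) \<le> ennreal (W \<omega> - h n \<omega>)"
      proof eventually_elim
        case (elim n)
        then have "psi S (A n) (Y \<omega>) \<le> ereal (rpsi S G (Y \<omega>) + t n * L)"
          unfolding psi_le_iff A_def by simp
        then have "f n \<omega> - rpsi S G (Y \<omega>) \<le> L * t n" using fin(1) by (simp add: mult.commute)
        then have "h n \<omega> \<le> L" unfolding h_def using t(1)[of n] by (simp add: pos_divide_le_eq)
        then show ?case by (intro ennreal_leI) simp
      qed
      then show "ennreal (W \<omega> - L) \<le> Z \<omega>" unfolding Z_def by (rule Liminf_bounded)
    qed
  qed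
qed

text \<open>With \<phi> zero and \<open>e = 1\<close> only the outward velocity \<open>P x\<close>
  remains. Where no maximiser exists, every real \<open>L\<close> is admissible, so \<open>Z\<close>
  is infinite there, against its finite integral.\<close>

lemma PG_nonempty_AE:
  assumes M: "prob_space M" and Y: "L2 M Y" and G: "optimal_dual_set S (distr M borel Y) G"
  shows "AE \<omega> in M. PG S G (Y \<omega>) \<noteq> {}"
proof -
  obtain D where D: "D > 0"
    "\<And>x y. \<bar>Sform S ((\<lambda>_. 0) x) (y - x)\<bar> \<le> D * (1 + norm y)"
    "\<And>x e. - Sform S (velocity (\<lambda>_. 0) e x) (velocity (\<lambda>_. 0) e x) / 2 \<le> D"
    "\<And>x y. Sform S (P x) (y - x) \<le> D * (norm y)\<^sup>2"
    using velocity_bounds[of "\<lambda>_. 0" 0 0] by auto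
  define W where "W = (\<lambda>\<omega>. D * (1 + norm (Y \<omega>)) + 1 * (D * (norm (Y \<omega>))\<^sup>2) + D)"
  obtain Z where Z: "Z \<in> borel_measurable M" "(\<integral>\<^sup>+\<omega>. Z \<omega> \<partial>M) \<le> ennreal (\<integral>\<omega>. W \<omega> \<partial>M)"
    "AE \<omega> in M. \<forall>L. (\<forall>x\<in>PG S G (Y \<omega>). Sform S (velocity (\<lambda>_. 0) 1 x) (Y \<omega> - x) < L) \<longrightarrow> ennreal (W \<omega> - L) \<le> Z \<omega>"
    unfolding W_def
    by (rule fatou_perturbation[OF M Y G, where \<phi> = "\<lambda>_. 0" and C = 0 and R = 0 and e = 1, OF _ _ _ _ D]) auto
  have "AE \<omega> in M. Z \<omega> \<noteq> \<infinity>"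
    using Z(1,2) by (intro nn_integral_PInf_AE) (auto simp: top_unique)
  then show ?thesis
    using Z(3)
  proof eventually_elim
    case (elim \<omega>)
    show ?case
    proof
      assume "PG S G (Y \<omega>) = {}"
      then have *: "ennreal (W \<omega> - L) \<le> Z \<omega>" for L using elim(2) by simp
      obtain r where r: "Z \<omega> = ennreal r" "r \<ge> 0" using elim(1) by (cases "Z \<omega>") auto
      then show False using *[of "W \<omega> - (r + 1)"] by (simp add: ennreal_le_iff)
    qed
  qed
qed

text \<open>The derivative in direction \<phi> is nonnegative up to the cost \<open>e * J\<close> of
  the extra velocity, and \<open>e\<close> is arbitrary. Compact support of \<phi> gives
  integrability before any moment of \<open>X\<close> is known.\<close>

lemma stationarity_nonneg:
  assumes M: "prob_space M" and Y: "L2 M Y" and G: "optimal_dual_set S (distr M borel Y) G"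
    and X: "X \<in> borel_measurable M" "AE \<omega> in M. PG S G (Y \<omega>) = {X \<omega>}"
    and cont: "continuous_on UNIV \<phi>" and bd: "\<And>x. norm (\<phi> x) \<le> C" and supp: "\<And>x. norm x > R \<Longrightarrow> \<phi> x = 0"
  shows "integrable M (\<lambda>\<omega>. Sform S (\<phi> (X \<omega>)) (Y \<omega> - X \<omega>))"
    and "0 \<le> (\<integral>\<omega>. Sform S (\<phi> (X \<omega>)) (Y \<omega> - X \<omega>) \<partial>M)"
proof -
  interpret prob_space M by fact
  note [measurable] = L2_measurable[OF Y] X(1)
  have [measurable]: "\<phi> \<in> borel_measurable borel" by (rule borel_measurable_continuous_onI[OF cont])
  obtain D where D: "D > 0"
    "\<And>x y. \<bar>Sform S (\<phi> x) (y - x)\<bar> \<le> D * (1 + norm y)"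
    "\<And>x e. - Sform S (velocity \<phi> e x) (velocity \<phi> e x) / 2 \<le> D"
    "\<And>x y. Sform S (P x) (y - x) \<le> D * (norm y)\<^sup>2"
    using velocity_bounds[of \<phi> C R] bd supp by blast
  define I where "I = (\<integral>\<omega>. Sform S (\<phi> (X \<omega>)) (Y \<omega> - X \<omega>) \<partial>M)"
  define J where "J = (\<integral>\<omega>. D * (norm (Y \<omega>))\<^sup>2 \<partial>M)"
  show int: "integrable M (\<lambda>\<omega>. Sform S (\<phi> (X \<omega>)) (Y \<omega> - X \<omega>))"
  proof (rule Bochner_Integration.integrable_bound)
    show "integrable M (\<lambda>\<omega>. D * (1 + norm (Y \<omega>)))" using L2_integrable_norm[OF M Y] by simp
    show "AE \<omega> in M. norm (Sform S (\<phi> (X \<omega>)) (Y \<omega> - X \<omega>)) \<le> norm (D * (1 + norm (Y \<omega>)))"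
      using D(1,2) by (auto simp: abs_mult)
  qed measurable
  have Ysq: "integrable M (\<lambda>\<omega>. D * (norm (Y \<omega>))\<^sup>2)" using L2_integrable_square[OF Y] by simp
  have main: "0 \<le> I + e * J" if e: "e > 0" for e
  proof -
    define W where "W = (\<lambda>\<omega>. D * (1 + norm (Y \<omega>)) + e * (D * (norm (Y \<omega>))\<^sup>2) + D)"
    \<comment> \<open>An upper bound for the speed at \<open>X\<close>: the part containing
      \<open>P (X \<omega>)\<close> is replaced by its bound in terms of \<open>Y\<close> alone,
      which is integrable.\<close>
    define u where "u = (\<lambda>\<omega>. Sform S (\<phi> (X \<omega>)) (Y \<omega> - X \<omega>) + e * (D * (norm (Y \<omega>))\<^sup>2))"
    obtain Z where Z: "Z \<in> borel_measurable M" "(\<integral>\<^sup>+\<omega>. Z \<omega> \<partial>M) \<le> ennreal (\<integral>\<omega>. W \<omega> \<partial>M)"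
      "AE \<omega> in M. \<forall>L. (\<forall>x\<in>PG S G (Y \<omega>). Sform S (velocity \<phi> e x) (Y \<omega> - x) < L) \<longrightarrow> ennreal (W \<omega> - L) \<le> Z \<omega>"
      unfolding W_def
      by (rule fatou_perturbation[OF M Y G cont bd supp e D]) auto
    have W_int: "integrable M W"
      unfolding W_def using L2_integrable_norm[OF M Y] L2_integrable_square[OF Y] by simp
    have u_int: "integrable M u" unfolding u_def using int Ysq by simp
    have uW: "u \<omega> \<le> W \<omega>" for \<omega>
      using D(1) D(2)[of "X \<omega>" "Y \<omega>"] by (simp add: u_def W_def)
    have "AE \<omega> in M. ennreal (W \<omega> - u \<omega>) \<le> Z \<omega>"
      using Z(3) X(2)
    proof eventually_elim
      case (elim \<omega>)
      have v: "Sform S (velocity \<phi> e (X \<omega>)) (Y \<omega> - X \<omega>) \<le> u \<omega>"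
        unfolding velocity_def u_def Sform.add_left Sform.scaleR_left
        using D(4)[of "X \<omega>" "Y \<omega>"] e by simp
      \<comment> \<open>The bound for \<open>Z\<close> requires a strict \<open>L\<close>, so it is
        used with \<open>u \<omega> + \<delta>\<close>.\<close>
      show ?case
      proof (rule ennreal_le_epsilon)
        fix \<delta> :: real assume "\<delta> > 0"
        then have "ennreal (W \<omega> - (u \<omega> + \<delta>)) \<le> Z \<omega>" using elim v by auto
        moreover have "ennreal (W \<omega> - u \<omega>) \<le> ennreal (W \<omega> - (u \<omega> + \<delta>)) + ennreal \<delta>"
          using \<open>\<delta> > 0\<close> by (cases "W \<omega> - (u \<omega> + \<delta>) \<ge> 0")
            (auto simp flip: ennreal_plus simp: ennreal_neg intro: ennreal_leI)
        ultimately show "ennreal (W \<omega> - u \<omega>) \<le> Z \<omega> + ennreal \<delta>"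
          by (meson add_right_mono order_trans)
      qed
    qed
    then have "(\<integral>\<^sup>+\<omega>. ennreal (W \<omega> - u \<omega>) \<partial>M) \<le> (\<integral>\<^sup>+\<omega>. Z \<omega> \<partial>M)" by (rule nn_integral_mono_AE)
    then have "ennreal (\<integral>\<omega>. W \<omega> - u \<omega> \<partial>M) \<le> ennreal (\<integral>\<omega>. W \<omega> \<partial>M)"
      using Z(2) W_int u_int uW by (subst nn_integral_eq_integral[symmetric]) auto
    moreover have "0 \<le> (\<integral>\<omega>. W \<omega> \<partial>M)" unfolding W_def using D(1) e by (intro integral_nonneg_AE) auto
    ultimately have "(\<integral>\<omega>. W \<omega> - u \<omega> \<partial>M) \<le> (\<integral>\<omega>. W \<omega> \<partial>M)" by (simp add: ennreal_le_iff)
    then have "0 \<le> (\<integral>\<omega>. u \<omega> \<partial>M)" using W_int u_int by simp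
    also have "\<dots> = I + e * J" unfolding u_def I_def J_def using int Ysq by simp
    finally show ?thesis .
  qed
  show "0 \<le> (\<integral>\<omega>. Sform S (\<phi> (X \<omega>)) (Y \<omega> - X \<omega>) \<partial>M)"
    unfolding I_def[symmetric]
  proof (rule ccontr)
    assume "\<not> 0 \<le> I"
    have "J \<ge> 0" unfolding J_def using D(1) by (intro integral_nonneg_AE) auto
    \<comment> \<open>This choice of \<open>e\<close> makes the cost at most half of
      \<open>- I\<close>; adding 1 to \<open>J\<close> covers the case \<open>J = 0\<close>.\<close>
    then have "(- I / (2 * (J + 1))) * J < - I"
      using \<open>\<not> 0 \<le> I\<close> by (simp add: field_simps) (smt (verit) mult_nonneg_nonneg mult_nonpos_nonneg)
    moreover have "- I / (2 * (J + 1)) > 0" using \<open>\<not> 0 \<le> I\<close> \<open>J \<ge> 0\<close> by (intro divide_pos_pos) auto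
    ultimately show False using main[of "- I / (2 * (J + 1))"] by linarith
  qed
qed

text \<open>The one-sided inequality also applies to the opposite field.\<close>

lemma stationarity:
  assumes M: "prob_space M" and Y: "L2 M Y" and G: "optimal_dual_set S (distr M borel Y) G"
    and X: "X \<in> borel_measurable M" "AE \<omega> in M. PG S G (Y \<omega>) = {X \<omega>}"
    and cont: "continuous_on UNIV \<phi>" and bd: "\<And>x. norm (\<phi> x) \<le> C" and supp: "\<And>x. norm x > R \<Longrightarrow> \<phi> x = 0"
  shows "(\<integral>\<omega>. Sform S (\<phi> (X \<omega>)) (Y \<omega> - X \<omega>) \<partial>M) = 0"
proof -
  have "0 \<le> (\<integral>\<omega>. Sform S (- \<phi> (X \<omega>)) (Y \<omega> - X \<omega>) \<partial>M)"
    using stationarity_nonneg(2)[OF M Y G X, of "\<lambda>x. - \<phi> x" C R] cont bd supp by (auto intro: continuous_intros)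
  moreover have "0 \<le> (\<integral>\<omega>. Sform S (\<phi> (X \<omega>)) (Y \<omega> - X \<omega>) \<partial>M)"
    using stationarity_nonneg(2)[OF M Y G X cont bd supp] .
  ultimately show ?thesis by (simp add: Sform.minus_left)
qed

end

section \<open>The projection is the optimal map\<close>

context sign_split
begin

definition cutoff :: "nat \<Rightarrow> real^'n \<Rightarrow> real" where
  "cutoff n x = max 0 (min 1 (real n + 1 - norm x))"

lemma cutoff_bounds: "0 \<le> cutoff n x" "cutoff n x \<le> 1"
  by (auto simp: cutoff_def)

lemma cutoff_eq_0: "norm x > real n + 1 \<Longrightarrow> cutoff n x = 0"
  by (simp add: cutoff_def)

lemma cutoff_eq_1: "norm x \<le> real n \<Longrightarrow> cutoff n x = 1"
  by (simp add: cutoff_def)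

lemma continuous_cutoff: "continuous_on A (cutoff n)"
  unfolding cutoff_def[abs_def] by (intro continuous_intros)

lemma dual_basis:
  obtains z :: "'n \<Rightarrow> real^'n" where "\<And>i y. Sform S (z i) y = y $ i"
proof -
  have "\<exists>z. \<forall>y. Sform S z y = y $ i" for i
    using nondeg[of "axis i 1"] by (simp add: inner_axis')
  then show thesis using that by metis
qed

text \<open>The test field is a cutoff of \<open>T x\<close>, where \<open>T\<close> turns
  \<open>S\<close> into the Euclidean product. Stationarity and
  \<open>2 x \<bullet> (y - x) \<le> |y|^2 - |x|^2\<close> bound the truncated second moment of
  \<open>X\<close> by that of \<open>Y\<close>; Fatou's lemma removes the cutoff.\<close>

lemma projection_L2:
  assumes M: "prob_space M" and Y: "L2 M Y" and G: "optimal_dual_set S (distr M borel Y) G"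
    and X: "X \<in> borel_measurable M" "AE \<omega> in M. PG S G (Y \<omega>) = {X \<omega>}"
  shows "L2 M X"
proof -
  interpret prob_space M by fact
  note [measurable] = L2_measurable[OF Y] X(1)
  obtain z where z: "\<And>i y. Sform S (z i) y = y $ i" by (rule dual_basis) blast
  define T where "T x = (\<Sum>i\<in>UNIV. (x $ i) *\<^sub>R z i)" for x
  have T: "Sform S (T x) y = x \<bullet> y" for x y
    by (simp add: T_def Sform.sum_left Sform.scaleR_left z inner_vec_def)
  have "linear T" unfolding T_def
    by (rule linearI) (simp_all add: scaleR_add_left sum.distrib scaleR_right.sum)
  then have blT: "bounded_linear T" by (simp add: linear_conv_bounded_linear)
  obtain B where B: "B > 0" "\<And>x. norm (T x) \<le> norm x * B"
    using bounded_linear.pos_bounded[OF blT] by blast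
  have cutm [measurable]: "cutoff n \<in> borel_measurable borel" for n
    by (rule borel_measurable_continuous_onI[OF continuous_cutoff])
  define q where "q n \<omega> = cutoff n (X \<omega>) * (norm (X \<omega>))\<^sup>2" for n \<omega>
  have [measurable]: "q n \<in> borel_measurable M" for n unfolding q_def[abs_def] by measurable
  have cut_le: "cutoff n x * (norm x)^k \<le> (real n + 1)^k" for n k and x :: "real^'n"
  proof (cases "norm x > real n + 1")
    case False
    then have "cutoff n x * (norm x)^k \<le> 1 * (real n + 1)^k"
      using cutoff_bounds[of n x] by (intro mult_mono power_mono) auto
    then show ?thesis by simp
  qed (simp add: cutoff_eq_0)
  have q_int: "integrable M (q n)" for n
    by (rule integrable_const_bound[of _ "(real n + 1)\<^sup>2"])
      (use cut_le[of n _ 2] cutoff_bounds in \<open>auto simp: q_def\<close>)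
  have q_le: "(\<integral>\<omega>. q n \<omega> \<partial>M) \<le> (\<integral>\<omega>. (norm (Y \<omega>))\<^sup>2 \<partial>M)" for n
  proof -
    define \<phi> where "\<phi> x = cutoff n x *\<^sub>R T x" for x
    have cont: "continuous_on UNIV \<phi>"
      unfolding \<phi>_def[abs_def] by (intro continuous_intros continuous_cutoff linear_continuous_on blT)
    have bd: "norm (\<phi> x) \<le> (real n + 1) * B" for x
    proof -
      have "norm (\<phi> x) \<le> cutoff n x * (norm x * B)"
        using cutoff_bounds[of n x] B(2)[of x] by (auto simp: \<phi>_def intro!: mult_left_mono)
      also have "\<dots> \<le> (real n + 1) * B"
        using mult_right_mono[OF cut_le[of n x 1], of B] B(1) by (simp add: mult.assoc)
      finally show ?thesis .
    qed
    have supp: "\<phi> x = 0" if "norm x > real n + 1" for x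
      using cutoff_eq_0[OF that] by (simp add: \<phi>_def)
    have eq: "Sform S (\<phi> x) y = cutoff n x * (x \<bullet> y)" for x y
      by (simp add: \<phi>_def Sform.scaleR_left T)
    have int: "integrable M (\<lambda>\<omega>. cutoff n (X \<omega>) * (X \<omega> \<bullet> (Y \<omega> - X \<omega>)))"
      and ge: "0 \<le> (\<integral>\<omega>. cutoff n (X \<omega>) * (X \<omega> \<bullet> (Y \<omega> - X \<omega>)) \<partial>M)"
      using stationarity_nonneg[OF M Y G X cont bd supp] unfolding eq by auto
    have "(\<integral>\<omega>. 2 * (cutoff n (X \<omega>) * (X \<omega> \<bullet> (Y \<omega> - X \<omega>))) \<partial>M) \<le> (\<integral>\<omega>. (norm (Y \<omega>))\<^sup>2 - q n \<omega> \<partial>M)"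
    proof (rule integral_mono)
      show "integrable M (\<lambda>\<omega>. 2 * (cutoff n (X \<omega>) * (X \<omega> \<bullet> (Y \<omega> - X \<omega>))))" using int by simp
      show "integrable M (\<lambda>\<omega>. (norm (Y \<omega>))\<^sup>2 - q n \<omega>)" using q_int L2_integrable_square[OF Y] by simp
      fix \<omega>
      let ?c = "cutoff n (X \<omega>)"
      have "0 \<le> (norm (Y \<omega> - X \<omega>))\<^sup>2" by simp
      then have "2 * (X \<omega> \<bullet> (Y \<omega> - X \<omega>)) \<le> (norm (Y \<omega>))\<^sup>2 - (norm (X \<omega>))\<^sup>2"
        unfolding power2_norm_eq_inner by (simp add: inner_diff_left inner_diff_right inner_commute)
      then have "?c * (2 * (X \<omega> \<bullet> (Y \<omega> - X \<omega>))) \<le> ?c * ((norm (Y \<omega>))\<^sup>2 - (norm (X \<omega>))\<^sup>2)"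
        using cutoff_bounds by (intro mult_left_mono) auto
      moreover have "?c * (norm (Y \<omega>))\<^sup>2 \<le> (norm (Y \<omega>))\<^sup>2"
        using cutoff_bounds[of n "X \<omega>"] by (intro mult_left_le_one_le) auto
      ultimately show "2 * (?c * (X \<omega> \<bullet> (Y \<omega> - X \<omega>))) \<le> (norm (Y \<omega>))\<^sup>2 - q n \<omega>"
        by (simp add: q_def algebra_simps)
    qed
    then show ?thesis using ge q_int L2_integrable_square[OF Y] by simp
  qed
  have "(\<integral>\<^sup>+\<omega>. ennreal ((norm (X \<omega>))\<^sup>2) \<partial>M) \<le> (\<integral>\<^sup>+\<omega>. liminf (\<lambda>n. ennreal (q n \<omega>)) \<partial>M)"
  proof (intro nn_integral_mono Liminf_bounded)
    fix \<omega>
    show "\<forall>\<^sub>F n in sequentially. ennreal ((norm (X \<omega>))\<^sup>2) \<le> ennreal (q n \<omega>)"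
      using eventually_ge_at_top[of "nat \<lceil>norm (X \<omega>)\<rceil>"]
    proof eventually_elim
      case (elim n)
      then have "norm (X \<omega>) \<le> real n" by linarith
      then show ?case by (simp add: q_def cutoff_eq_1)
    qed
  qed
  also have "\<dots> \<le> liminf (\<lambda>n. \<integral>\<^sup>+\<omega>. ennreal (q n \<omega>) \<partial>M)"
    by (rule nn_integral_liminf) measurable
  also have "\<dots> \<le> liminf (\<lambda>n. ennreal (\<integral>\<omega>. (norm (Y \<omega>))\<^sup>2 \<partial>M))"
  proof (intro Liminf_mono always_eventually allI)
    fix n
    have "(\<integral>\<^sup>+\<omega>. ennreal (q n \<omega>) \<partial>M) = ennreal (\<integral>\<omega>. q n \<omega> \<partial>M)"
      by (rule nn_integral_eq_integral[OF q_int]) (use cutoff_bounds in \<open>simp add: q_def\<close>)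
    then show "(\<integral>\<^sup>+\<omega>. ennreal (q n \<omega>) \<partial>M) \<le> ennreal (\<integral>\<omega>. (norm (Y \<omega>))\<^sup>2 \<partial>M)"
      using q_le by (simp add: ennreal_leI)
  qed
  also have "\<dots> < \<infinity>" by (simp add: Liminf_const)
  finally have "integrable M (\<lambda>\<omega>. (norm (X \<omega>))\<^sup>2)"
    by (intro integrableI_nonneg) auto
  then show ?thesis using X(1) by (simp add: L2_def)
qed

text \<open>Fields along the S-dual vector \<open>z i\<close> read off the coordinate
  \<open>i\<close> of \<open>Y - X\<close>. Their scalar factors approximate indicators of closed
  sets, which determine all Borel events of \<open>X\<close>.\<close>

lemma projection_martingale:
  assumes M: "prob_space M" and Y: "L2 M Y" and G: "optimal_dual_set S (distr M borel Y) G"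
    and X: "X \<in> borel_measurable M" "AE \<omega> in M. PG S G (Y \<omega>) = {X \<omega>}"
  shows "martingale_pair M X Y"
proof (rule martingale_pairI[OF M projection_L2[OF assms] Y])
  interpret prob_space M by fact
  note [measurable] = L2_measurable[OF Y] X(1)
  fix i :: 'n and B :: "(real^'n) set"
  obtain z where z: "\<And>i y. Sform S (z i) y = y $ i" by (rule dual_basis) blast
  define h where "h \<omega> = Y \<omega> $ i - X \<omega> $ i" for \<omega>
  have D2: "L2 M (\<lambda>\<omega>. Y \<omega> - X \<omega>)" by (rule L2_diff[OF Y projection_L2[OF assms]])
  have h_int: "integrable M h"
    using L2_mult_integrable[OF _ L2_component(1)[OF D2, of i], of "\<lambda>_. 1"] L2_component(2)[OF D2, of i]
    by (simp add: h_def[abs_def])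
  then have [measurable]: "h \<in> borel_measurable M" by simp
  have closed_zero: "(\<integral>\<omega>. indicator C (X \<omega>) * h \<omega> \<partial>M) = 0" if C: "closed C" for C
  proof (cases "C = {}")
    case False
    \<comment> \<open>Tents of slope \<open>n\<close> shrink to the indicator of \<open>C\<close>,
      and the cutoff gives compact support. The empty set is treated apart because
      \<open>infdist\<close> to it is 0, so the tents would tend to 1.\<close>
    define \<theta> where "\<theta> n x = max 0 (1 - real n * infdist x C) * cutoff n x" for n x
    have \<theta>_cont: "continuous_on UNIV (\<theta> n)" for n
      unfolding \<theta>_def[abs_def] by (intro continuous_intros continuous_cutoff)
    then have [measurable]: "\<theta> n \<in> borel_measurable borel" for n by (rule borel_measurable_continuous_onI)
    have \<theta>_le: "\<bar>\<theta> n x\<bar> \<le> 1" for n x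
    proof -
      have "\<bar>\<theta> n x\<bar> = max 0 (1 - real n * infdist x C) * cutoff n x"
        using cutoff_bounds[of n x] by (simp add: \<theta>_def abs_mult)
      also have "\<dots> \<le> 1 * 1"
        using cutoff_bounds[of n x] by (intro mult_mono) (auto simp: infdist_nonneg)
      finally show ?thesis by simp
    qed
    have \<theta>_lim: "(\<lambda>n. \<theta> n x) \<longlonglongrightarrow> indicator C x" for x
    proof (rule tendsto_eventually)
      show "\<forall>\<^sub>F n in sequentially. \<theta> n x = indicator C x"
      proof (cases "x \<in> C")
        case True
        show ?thesis
          using eventually_ge_at_top[of "nat \<lceil>norm x\<rceil>"]
        proof eventually_elim
          case (elim n)
          then have "norm x \<le> real n" by linarith
          then show ?case using True by (simp add: \<theta>_def cutoff_eq_1)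
        qed
      next
        case outside: False
        then have d: "infdist x C > 0"
          using in_closed_iff_infdist_zero[OF C \<open>C \<noteq> {}\<close>, of x] infdist_nonneg[of x C] by linarith
        show ?thesis
          using eventually_ge_at_top[of "nat \<lceil>1 / infdist x C\<rceil>"]
        proof eventually_elim
          case (elim n)
          then have "1 / infdist x C \<le> real n" by linarith
          then have "1 \<le> real n * infdist x C" using d by (simp add: field_simps)
          then show ?case using outside by (simp add: \<theta>_def)
        qed
      qed
    qed
    have zero: "(\<integral>\<omega>. \<theta> n (X \<omega>) * h \<omega> \<partial>M) = 0" for n
    proof -
      have "(\<integral>\<omega>. Sform S (\<theta> n (X \<omega>) *\<^sub>R z i) (Y \<omega> - X \<omega>) \<partial>M) = 0"
      proof (rule stationarity[OF M Y G X, of "\<lambda>x. \<theta> n x *\<^sub>R z i" "norm (z i)" "real n + 1"])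
        show "continuous_on UNIV (\<lambda>x. \<theta> n x *\<^sub>R z i)" by (intro continuous_intros \<theta>_cont)
        show "norm (\<theta> n x *\<^sub>R z i) \<le> norm (z i)" for x
          using \<theta>_le[of n x] by (simp add: mult_left_le_one_le)
        show "\<theta> n x *\<^sub>R z i = 0" if "norm x > real n + 1" for x
          using cutoff_eq_0[OF that] by (simp add: \<theta>_def)
      qed
      then show ?thesis by (simp add: Sform.scaleR_left z h_def)
    qed
    have "(\<lambda>n. \<integral>\<omega>. \<theta> n (X \<omega>) * h \<omega> \<partial>M) \<longlonglongrightarrow> (\<integral>\<omega>. indicator C (X \<omega>) * h \<omega> \<partial>M)"
    proof (rule integral_dominated_convergence)
      show "integrable M (\<lambda>\<omega>. \<bar>h \<omega>\<bar>)" using h_int by simp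
      have "C \<in> sets borel" using C by simp
      then show "(\<lambda>\<omega>. indicator C (X \<omega>) * h \<omega>) \<in> borel_measurable M" by measurable
      show "(\<lambda>\<omega>. \<theta> n (X \<omega>) * h \<omega>) \<in> borel_measurable M" for n by measurable
      show "AE \<omega> in M. (\<lambda>n. \<theta> n (X \<omega>) * h \<omega>) \<longlonglongrightarrow> indicator C (X \<omega>) * h \<omega>"
        by (intro AE_I2 tendsto_mult_right \<theta>_lim)
      show "AE \<omega> in M. norm (\<theta> n (X \<omega>) * h \<omega>) \<le> \<bar>h \<omega>\<bar>" for n
        using \<theta>_le by (auto simp: abs_mult intro!: mult_left_le_one_le)
    qed
    then show ?thesis unfolding zero by (simp add: LIMSEQ_const_iff)
  qed simp
  assume "B \<in> sets borel"
  then show "(\<integral>\<omega>. indicator B (X \<omega>) * (Y \<omega> $ i - X \<omega> $ i) \<partial>M) = 0"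
    using integral_indicator_zero_borel[OF X(1) h_int closed_zero, of B] by (simp add: h_def)
qed

text \<open>The value identity comes from integrating the attained tangent at \<open>X\<close> and
  using \<open>E[S(X,Y)] = E[S(X,X)]\<close>. The probability space is left free, so that the lemma
  can also be applied to a plan in place of \<open>M\<close>, with \<open>snd\<close> in place of
  \<open>Y\<close>.\<close>

lemma projection_optimal:
  assumes M: "prob_space M" and Y: "L2 M Y" and G: "optimal_dual_set S (distr M borel Y) G"
    and single: "AE y in distr M borel Y. y \<notin> Sigma_PG S G"
  defines "X \<equiv> \<lambda>\<omega>. PG_map S G (Y \<omega>)"
  shows "martingale_pair M X Y"
    and "(\<integral>\<omega>. Sform S (X \<omega>) (Y \<omega>) \<partial>M) / 2 = (\<integral>\<omega>. rpsi S G (Y \<omega>) \<partial>M)"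
    and "martingale_pair M U Y \<Longrightarrow> (\<integral>\<omega>. Sform S (U \<omega>) (Y \<omega>) \<partial>M) / 2 \<le> (\<integral>\<omega>. rpsi S G (Y \<omega>) \<partial>M)"
    and "martingale_pair M U Y \<Longrightarrow> (\<integral>\<omega>. Sform S (U \<omega>) (Y \<omega>) \<partial>M) / 2 = (\<integral>\<omega>. rpsi S G (Y \<omega>) \<partial>M)
      \<Longrightarrow> AE \<omega> in M. U \<omega> = X \<omega>"
proof -
  have GM: "G \<in> MS S" using G by (simp add: optimal_dual_set_def)
  note [measurable] = L2_measurable[OF Y] borel_measurable_PG_map[OF closed_maximal[OF GM]]
  have X_meas: "X \<in> borel_measurable M" unfolding X_def by measurable
  have "AE \<omega> in M. Y \<omega> \<notin> Sigma_PG S G"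
    using AE_distrD[OF _ single] by simp
  then have PGX: "AE \<omega> in M. PG S G (Y \<omega>) = {X \<omega>}"
    using PG_nonempty_AE[OF M Y G] unfolding X_def by eventually_elim (rule PG_map_eq)
  show mart: "martingale_pair M X Y" by (rule projection_martingale[OF M Y G X_meas PGX])
  note r = optimal_dual_rpsi[OF Y G]
  show "martingale_pair M U Y \<Longrightarrow> (\<integral>\<omega>. Sform S (U \<omega>) (Y \<omega>) \<partial>M) / 2 \<le> (\<integral>\<omega>. rpsi S G (Y \<omega>) \<partial>M)"
    by (rule weak_duality(1)[OF M _ GM r])
  show "AE \<omega> in M. U \<omega> = X \<omega>"
    if "martingale_pair M U Y" "(\<integral>\<omega>. Sform S (U \<omega>) (Y \<omega>) \<partial>M) / 2 = (\<integral>\<omega>. rpsi S G (Y \<omega>) \<partial>M)"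
    using weak_duality(2)[OF M that(1) GM r that(2)] PGX by eventually_elim simp
  have X2: "L2 M X" using mart by (simp add: martingale_pair_def)
  have XY: "(\<integral>\<omega>. Sform S (X \<omega>) (Y \<omega>) \<partial>M) = (\<integral>\<omega>. Sform S (X \<omega>) (X \<omega>) \<partial>M)"
    using martingale_pair_Sform[OF M mart, of "\<lambda>x. x"] X2 by simp
  have "(\<integral>\<omega>. rpsi S G (Y \<omega>) \<partial>M) = (\<integral>\<omega>. tangent S (X \<omega>) (Y \<omega>) \<partial>M)"
  proof (rule integral_cong_AE)
    show "AE \<omega> in M. rpsi S G (Y \<omega>) = tangent S (X \<omega>) (Y \<omega>)"
      using PGX
    proof eventually_elim
      case (elim \<omega>)
      then have "X \<omega> \<in> PG S G (Y \<omega>)" by simp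
      then have "psi S G (Y \<omega>) = ereal (tangent S (X \<omega>) (Y \<omega>))"
        unfolding PG_iff psi_def tangent_def by (intro antisym SUP_least SUP_upper2[of "X \<omega>"]) auto
      then show ?case by simp
    qed
  qed (use r(1) X_meas in \<open>auto simp: tangent_def\<close>)
  also have "\<dots> = (\<integral>\<omega>. Sform S (X \<omega>) (Y \<omega>) \<partial>M) - (\<integral>\<omega>. Sform S (X \<omega>) (X \<omega>) \<partial>M) / 2"
    unfolding tangent_def using L2_Sform_integrable[OF X2 Y, of S] L2_Sform_integrable[OF X2 X2, of S] by simp
  finally show "(\<integral>\<omega>. Sform S (X \<omega>) (Y \<omega>) \<partial>M) / 2 = (\<integral>\<omega>. rpsi S G (Y \<omega>) \<partial>M)" using XY by simp
qed

end

section \<open>From random variables to plans\<close>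

lemma L2_distr:
  assumes [measurable]: "f \<in> measurable M N" and A: "A \<in> borel_measurable N"
  shows "L2 (distr M N f) A \<longleftrightarrow> L2 M (\<lambda>\<omega>. A (f \<omega>))"
  unfolding L2_def using A by (auto simp: integrable_distr_eq)

lemma measurable_fst_snd_borel [measurable]:
  "fst \<in> borel_measurable (borel :: ('a::euclidean_space \<times> 'b::euclidean_space) measure)"
  "snd \<in> borel_measurable (borel :: ('a::euclidean_space \<times> 'b::euclidean_space) measure)"
  by (auto intro!: borel_measurable_continuous_onI continuous_intros)

text \<open>Tested on events of the first variable, the martingale property depends only on the
  joint law.\<close>

lemma martingale_pair_law:
  assumes M: "prob_space M" and mart: "martingale_pair M X Y"
  shows "martingale_pair (distr M borel (\<lambda>\<omega>. (X \<omega>, Y \<omega>))) fst snd"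
proof -
  have X: "L2 M X" and Y: "L2 M Y" using mart by (auto simp: martingale_pair_def)
  note [measurable] = L2_measurable[OF X] L2_measurable[OF Y]
  have XY: "(\<lambda>\<omega>. (X \<omega>, Y \<omega>)) \<in> borel_measurable M" by (rule borel_measurable_Pair) measurable
  let ?\<gamma> = "distr M borel (\<lambda>\<omega>. (X \<omega>, Y \<omega>))"
  have "prob_space ?\<gamma>" by (rule prob_space.prob_space_distr[OF M XY])
  then show ?thesis
  proof (rule martingale_pairI)
    show "L2 ?\<gamma> fst" "L2 ?\<gamma> snd" using X Y by (auto simp: L2_distr[OF XY])
    fix i and B :: "(real^'b) set" assume [measurable]: "B \<in> sets borel"
    have m: "(\<lambda>x::real^'b. x $ i) \<in> borel_measurable borel"
      by (intro borel_measurable_continuous_onI continuous_intros)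
    have w: "(\<lambda>x. indicator B x *\<^sub>R axis i 1 :: real^'b) \<in> borel_measurable borel" by measurable
    have L2w: "L2 M (\<lambda>\<omega>. indicator B (X \<omega>) *\<^sub>R axis i 1 :: real^'b)"
      by (rule L2_bound[OF M X, of _ 1]) (auto simp: indicator_def)
    have "(\<integral>p. indicator B (fst p) * (snd p $ i - fst p $ i) \<partial>?\<gamma>) = (\<integral>\<omega>. indicator B (X \<omega>) * (Y \<omega> $ i - X \<omega> $ i) \<partial>M)"
    proof (subst integral_distr[OF XY])
      note [measurable] = measurable_compose[OF measurable_fst_snd_borel(1) m] measurable_compose[OF measurable_fst_snd_borel(2) m]
      show "(\<lambda>p. indicator B (fst p) * (snd p $ i - fst p $ i) :: real) \<in> borel_measurable borel" by measurable
    qed simp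
    also have "\<dots> = 0"
    proof -
      have int: "integrable M (\<lambda>\<omega>. indicator B (X \<omega>) * A \<omega> $ i)" if "L2 M A" for A :: "_ \<Rightarrow> real^'b"
        using L2_mult_integrable[OF L2_component(1)[OF L2w] L2_component(1)[OF that] L2_component(2)[OF L2w] L2_component(2)[OF that], of i i]
        by (simp add: axis_def)
      show ?thesis
        using martingale_pair_test[OF M mart w L2w] int[OF X] int[OF Y]
        by (simp add: right_diff_distrib inner_axis')
    qed
    finally show "(\<integral>p. indicator B (fst p) * (snd p $ i - fst p $ i) \<partial>?\<gamma>) = 0" .
  qed
qed

lemma Xset_iff:
  assumes "L2 M Y"
  shows "X \<in> Xset M Y \<longleftrightarrow> martingale_pair M X Y \<and> X \<in> measurable (vimage_algebra (space M) Y borel) borel"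
  using assms by (auto simp: Xset_def martingale_pair_def)

text \<open>The squared norm on the product is the sum of the squared norms of the coordinates, so a
  finite second moment of the plan is square integrability of both.\<close>

lemma Gamma_iff:
  "\<gamma> \<in> Gamma \<nu> \<longleftrightarrow> sets \<gamma> = sets borel \<and> prob_space \<gamma> \<and> distr \<gamma> borel snd = \<nu> \<and> martingale_pair \<gamma> fst snd"
proof -
  have "integrable \<gamma> (\<lambda>p. (norm p)\<^sup>2) \<longleftrightarrow> L2 \<gamma> fst \<and> L2 \<gamma> snd" if s: "sets \<gamma> = sets borel"
  proof -
    have m: "fst \<in> borel_measurable \<gamma>" "snd \<in> borel_measurable \<gamma>" "(\<lambda>p. p) \<in> borel_measurable \<gamma>"
      using measurable_fst_snd_borel by (auto simp: measurable_cong_sets[OF s refl])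
    note [measurable] = m
    have sq: "(norm p)\<^sup>2 = (norm (fst p))\<^sup>2 + (norm (snd p))\<^sup>2" for p :: "(real^'a) \<times> (real^'a)"
      by (simp add: norm_prod_def)
    have "integrable \<gamma> (\<lambda>p. (norm (fst p))\<^sup>2)" "integrable \<gamma> (\<lambda>p. (norm (snd p))\<^sup>2)"
      if "integrable \<gamma> (\<lambda>p. (norm p)\<^sup>2)"
      by (rule Bochner_Integration.integrable_bound[OF that]; auto simp: sq)+
    moreover have "integrable \<gamma> (\<lambda>p. (norm p)\<^sup>2)"
      if "integrable \<gamma> (\<lambda>p. (norm (fst p))\<^sup>2)" "integrable \<gamma> (\<lambda>p. (norm (snd p))\<^sup>2)"
      unfolding sq using that by simp
    ultimately show ?thesis using m by (auto simp: L2_def)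
  qed
  then show ?thesis by (auto simp: Gamma_def martingale_pair_def)
qed

theorem theorem5:
  fixes S :: "real^'n^'n" and m :: nat and M :: "'w measure"
    and Y :: "'w \<Rightarrow> real^'n" and G :: "(real^'n) set"
  assumes "S \<in> Sdm m"
    and "prob_space M"
    and "L2 M Y"
    and "optimal_dual_set S (distr M borel Y) G"
    and "AE y in distr M borel Y. y \<notin> Sigma_PG S G"
  defines "X \<equiv> (\<lambda>\<omega>. if Y \<omega> \<notin> Sigma_PG S G then (THE x. PG S G (Y \<omega>) = {x}) else 0)"
  shows "optimal_map S M Y X
    \<and> (\<forall>X'. optimal_map S M Y X' \<longrightarrow> (AE \<omega> in M. X' \<omega> = X \<omega>))
    \<and> optimal_plan S (distr M borel Y) (distr M borel (\<lambda>\<omega>. (X \<omega>, Y \<omega>)))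
    \<and> (\<forall>\<gamma>. optimal_plan S (distr M borel Y) \<gamma> \<longrightarrow> \<gamma> = distr M borel (\<lambda>\<omega>. (X \<omega>, Y \<omega>)))"
proof -
  obtain P \<kappa> where "sign_split S P \<kappa>" using Sdm_sign_split[OF assms(1)] by blast
  then interpret sign_split S P \<kappa> .
  note M = assms(2) and Y = assms(3) and G = assms(4) and single = assms(5)
  have GM: "G \<in> MS S" using G by (simp add: optimal_dual_set_def)
  have X_eq: "X = (\<lambda>\<omega>. PG_map S G (Y \<omega>))" by (simp add: X_def PG_map_def)
  note opt = projection_optimal[OF M Y G single, folded X_eq[THEN fun_cong]]
  note pm = borel_measurable_PG_map[OF closed_maximal[OF GM], of S]
  note [measurable] = L2_measurable[OF Y] pm
  have X_meas [measurable]: "X \<in> borel_measurable M" unfolding X_eq by measurable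
  have X_Ymeas: "X \<in> measurable (vimage_algebra (space M) Y borel) borel"
    unfolding X_eq by (rule measurable_compose[OF measurable_vimage_algebra1 pm]) simp
  let ?\<nu> = "distr M borel Y" and ?\<gamma> = "distr M borel (\<lambda>\<omega>. (X \<omega>, Y \<omega>))"
  let ?v = "\<integral>\<omega>. rpsi S G (Y \<omega>) \<partial>M"
  have XY: "(\<lambda>\<omega>. (X \<omega>, Y \<omega>)) \<in> borel_measurable M" by (rule borel_measurable_Pair) measurable
  have X_in: "X \<in> Xset M Y" using opt(1) X_Ymeas by (simp add: Xset_iff[OF Y])
  have map: "optimal_map S M Y X"
    unfolding optimal_map_def opt(2) using X_in opt(3) by (simp add: Xset_iff[OF Y])
  have map_unique: "AE \<omega> in M. X' \<omega> = X \<omega>" if X': "optimal_map S M Y X'" for X'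
  proof (rule opt(4))
    show mart: "martingale_pair M X' Y" using X' by (simp add: optimal_map_def Xset_iff[OF Y])
    have "?v \<le> (\<integral>\<omega>. Sform S (X' \<omega>) (Y \<omega>) \<partial>M) / 2"
      using X' X_in unfolding optimal_map_def opt(2)[symmetric] by blast
    then show "(\<integral>\<omega>. Sform S (X' \<omega>) (Y \<omega>) \<partial>M) / 2 = ?v" using opt(3)[OF mart] by simp
  qed
  have \<gamma>_in: "?\<gamma> \<in> Gamma ?\<nu>"
    unfolding Gamma_iff
    using martingale_pair_law[OF M opt(1)] prob_space.prob_space_distr[OF M XY] XY
    by (simp add: distr_distr o_def)
  have \<gamma>_val: "(\<integral>p. Sform S (fst p) (snd p) \<partial>?\<gamma>) / 2 = ?v"
    using opt(2) by (subst integral_distr[OF XY]) auto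
  have plan_le: "(\<integral>p. Sform S (fst p) (snd p) \<partial>\<gamma>) / 2 \<le> ?v"
    and plan_eq: "(\<integral>p. Sform S (fst p) (snd p) \<partial>\<gamma>) / 2 = ?v \<Longrightarrow> \<gamma> = ?\<gamma>"
    if "\<gamma> \<in> Gamma ?\<nu>" for \<gamma>
  proof -
    have s: "sets \<gamma> = sets borel" and \<gamma>: "prob_space \<gamma>" and marg: "distr \<gamma> borel snd = ?\<nu>"
      and mart: "martingale_pair \<gamma> fst snd" using that by (auto simp: Gamma_iff)
    have snd2: "L2 \<gamma> snd" using mart by (simp add: martingale_pair_def)
    have fm [measurable]: "fst \<in> borel_measurable \<gamma>" "snd \<in> borel_measurable \<gamma>"
      using mart by (auto simp: martingale_pair_def L2_def)
    \<comment> \<open>The plan is taken as the probability space itself; its second marginal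
      identifies the dual problem with the original one.\<close>
    note o = projection_optimal[OF \<gamma> snd2, unfolded marg, OF G single]
    have v: "(\<integral>p. rpsi S G (snd p) \<partial>\<gamma>) = ?v"
      using integral_distr[of snd \<gamma> borel "rpsi S G"] integral_distr[of Y M borel "rpsi S G"] marg by simp
    show "(\<integral>p. Sform S (fst p) (snd p) \<partial>\<gamma>) / 2 \<le> ?v" using o(3)[OF mart] v by simp
    assume "(\<integral>p. Sform S (fst p) (snd p) \<partial>\<gamma>) / 2 = ?v"
    then have AE: "AE p in \<gamma>. fst p = PG_map S G (snd p)" using o(4)[OF mart] v by simp
    have pair: "(\<lambda>y. (PG_map S G y, y)) \<in> borel_measurable borel" by (rule borel_measurable_Pair) measurable
    \<comment> \<open>An optimal plan is carried by the graph of \<open>PG_map S G\<close>, so it is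
      the image of its second marginal and hence determined by it.\<close>
    have "\<gamma> = distr \<gamma> borel (\<lambda>p. p)" using distr_id2[OF s[symmetric]] by simp
    also have "\<dots> = distr \<gamma> borel (\<lambda>p. (PG_map S G (snd p), snd p))"
    proof (rule distr_cong_AE[OF refl refl])
      show "AE p in \<gamma>. p = (PG_map S G (snd p), snd p)" using AE by eventually_elim (metis prod.collapse)
      show "(\<lambda>p. p) \<in> borel_measurable \<gamma>" by (simp add: measurable_cong_sets[OF s refl])
      show "(\<lambda>p. (PG_map S G (snd p), snd p)) \<in> borel_measurable \<gamma>" by (rule measurable_compose[OF fm(2) pair])
    qed
    also have "\<dots> = distr (distr \<gamma> borel snd) borel (\<lambda>y. (PG_map S G y, y))"
      by (simp add: distr_distr[OF pair fm(2)] o_def)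
    also have "\<dots> = ?\<gamma>" unfolding marg X_eq by (subst distr_distr[OF pair]) (auto simp: o_def)
    finally show "\<gamma> = ?\<gamma>" .
  qed
  have plan: "optimal_plan S ?\<nu> ?\<gamma>" unfolding optimal_plan_def using \<gamma>_in \<gamma>_val plan_le by auto
  have plan_unique: "\<gamma> = ?\<gamma>" if "optimal_plan S ?\<nu> \<gamma>" for \<gamma>
  proof (rule plan_eq)
    show \<gamma>: "\<gamma> \<in> Gamma ?\<nu>" using that by (simp add: optimal_plan_def)
    have "?v \<le> (\<integral>p. Sform S (fst p) (snd p) \<partial>\<gamma>) / 2"
      using that \<gamma>_in unfolding optimal_plan_def \<gamma>_val[symmetric] by blast
    then show "(\<integral>p. Sform S (fst p) (snd p) \<partial>\<gamma>) / 2 = ?v" using plan_le[OF \<gamma>] by simp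
  qed
  show ?thesis using map map_unique plan plan_unique by blast
qed

end
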